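(* Let $\Phi$ be a stationary Poisson point process of intensity $\lambda>0$ in $\mathbb{R}^3$, let $\Upsilon$ be the point process on the $x$-axis formed by the intersections of the $x$-axis with the two-dimensional facets of the Voronoi tessellation of $\Phi$, and for $Z\in\Upsilon$ let $\Theta(Z)\in(0,2\pi)$ be the angle at which $Z$ sees the two nuclei creating the facet that contains $Z$. Then the Palm distribution with respect to $\Upsilon$ of $\Theta=\Theta(0)$ has the density $$f_\Theta(t)=\frac34\left|\cos\frac t2\right|\sin^2\frac t2,\qquad t\in(0,2\pi).$$
   Context: The Voronoi cell with nucleus $X\in\Phi$ is $\mathcal{V}_X=\{x\in\mathbb{R}^3:\ \|x-X\|\le \inf_{Y\in\Phi\setminus\{X\}}\|x-Y\|\}$. The two-dimensional facets of the tessellation are the two-dimensional sets of the form $\mathcal{V}_X\cap\mathcal{V}_Y$ with $X\ne Y$ in $\Phi$; the points $X$ and $Y$ are the nuclei creating the facet. Almost surely, each point $Z$ of $\Upsilon$ belongs to a two-dimensional facet; $X_1(Z)$ and $X_2(Z)$ denote the two nuclei creating it, ordered by a fixed intrinsic order on pairs of points (e.g., the natural order on the $x$-coordinate), with $X_1(Z)<X_2(Z)$. The angle $\Theta(Z)\in(0,2\pi)$ is the angle from $X_1(Z)$ to $X_2(Z)$ as seen from $Z$, measured in the plane that contains $X_1(Z)$, $X_2(Z)$ and $Z$. No further convention on the orientation of this plane is specified; the density on $(\pi,2\pi)$ is obtained from that on $(0,\pi)$ by the symmetry $t\mapsto 2\pi-t$. $\Upsilon$ is a stationary point process on the $x$-axis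 (identified with $\mathbb{R}$), with linear intensity $\mu(3)=\left(\frac{4\pi}{3}\right)^{1/3}\Gamma(5/3)\lambda^{1/3}$, and the $\Theta(Z)$ are marks of $\Upsilon$. The Palm distribution of $\Theta$ with respect to $\Upsilon$ (and not with respect to $\Phi$) is the probability measure $$\mathbb{P}^0_\Upsilon(\Theta(0)\in B)=\frac1{\mu(3)}\,\mathbb{E}\Big[\sum_{Z\in\Upsilon}\mathbf{1}_{Z\in[0,1]}\mathbf{1}_{\Theta(Z)\in B}\Big],\qquad B\subset(0,2\pi)\ \text{Borel}.$$ *)

theory Defs
  imports "HOL-Probability.Probability"
begin

(* A homogeneous Poisson point process is simple, so it is represented by the random locally
   finite set of its points. *)
definition stationary_poisson_process ::
    "'w measure \<Rightarrow> real \<Rightarrow> ('w \<Rightarrow> (real^3) set) \<Rightarrow> bool" where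
  "stationary_poisson_process M lam \<Phi> \<longleftrightarrow>
     prob_space M \<and>
     (\<forall>\<omega>\<in>space M. \<forall>B. bounded B \<longrightarrow> finite (\<Phi> \<omega> \<inter> B)) \<and>
     (\<forall>B\<in>sets borel. bounded B \<longrightarrow>
        (\<lambda>\<omega>. card (\<Phi> \<omega> \<inter> B)) \<in> measurable M (count_space UNIV) \<and>
        (\<forall>k. measure M {\<omega>\<in>space M. card (\<Phi> \<omega> \<inter> B) = k} =
               (lam * measure lborel B) ^ k / fact k * exp (- (lam * measure lborel B)))) \<and>
     (\<forall>(A :: nat \<Rightarrow> (real^3) set) I.
        finite I \<longrightarrow> (\<forall>i\<in>I. A i \<in> sets borel \<and> bounded (A i)) \<longrightarrow> disjoint_family_on A I \<longrightarrow>
        prob_space.indep_vars M (\<lambda>_. count_space UNIV) (\<lambda>i \<omega>. card (\<Phi> \<omega> \<inter> A i)) I)"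

(* The infimum is taken in the extended reals, so that it is infinite over the empty set. *)
definition voronoi_cell :: "(real^3) set \<Rightarrow> real^3 \<Rightarrow> (real^3) set" where
  "voronoi_cell P X = {x. ereal (norm (x - X)) \<le> (INF Y\<in>P - {X}. ereal (norm (x - Y)))}"

definition creates_facet :: "(real^3) set \<Rightarrow> real^3 \<Rightarrow> real^3 \<Rightarrow> bool" where
  "creates_facet P X Y \<longleftrightarrow>
     X \<in> P \<and> Y \<in> P \<and> X \<noteq> Y \<and> aff_dim (voronoi_cell P X \<inter> voronoi_cell P Y) = 2"

definition x_axis_point :: "real \<Rightarrow> real^3" where
  "x_axis_point z = axis 1 z"

definition axis_facet_points :: "(real^3) set \<Rightarrow> real set" where
  "axis_facet_points P =
     {z. \<exists>X Y. creates_facet P X Y \<and> x_axis_point z \<in> voronoi_cell P X \<inter> voronoi_cell P Y}"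

(* The pair (X1, X2) of nuclei creating the facet through the point z of the axis, ordered by
   x-coordinate. For a Poisson process it is almost surely unique at every point of
   axis_facet_points. *)
definition facet_nuclei :: "(real^3) set \<Rightarrow> real \<Rightarrow> (real^3) \<times> (real^3)" where
  "facet_nuclei P z =
     (THE (X, Y). creates_facet P X Y \<and> x_axis_point z \<in> voronoi_cell P X \<inter> voronoi_cell P Y \<and>
        X $ 1 < Y $ 1)"

(* Angle from X to Y seen from Z, measured counterclockwise in the plane through X, Y, Z when that
   plane is viewed from the side into which u points. (Degenerate cases: X, Y, Z collinear, or u
   parallel to the plane.) *)
definition oriented_angle :: "real^3 \<Rightarrow> real^3 \<Rightarrow> real^3 \<Rightarrow> real^3 \<Rightarrow> real" where
  "oriented_angle u Z X Y =
     (let a = X - Z; b = Y - Z; \<alpha> = arccos (a \<bullet> b / (norm a * norm b))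
      in if cross3 a b \<bullet> u > 0 then \<alpha> else 2 * pi - \<alpha>)"

definition facet_angle :: "real^3 \<Rightarrow> (real^3) set \<Rightarrow> real \<Rightarrow> real" where
  "facet_angle u P z =
     (case facet_nuclei P z of (X, Y) \<Rightarrow> oriented_angle u (x_axis_point z) X Y)"

(* The intensity of axis_facet_points for a Poisson process of intensity lam. *)
definition facet_intensity :: "real \<Rightarrow> real" where
  "facet_intensity lam = (4 * pi / 3) powr (1/3) * Gamma (5/3) * lam powr (1/3)"

(* Palm distribution of the marks of a stationary point process on the line of intensity \<mu>. *)
definition palm_mark_distribution ::
    "'w measure \<Rightarrow> real \<Rightarrow> ('w \<Rightarrow> real set) \<Rightarrow> ('w \<Rightarrow> real \<Rightarrow> real) \<Rightarrow> real set \<Rightarrow> ennreal" where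
  "palm_mark_distribution M \<mu> \<Upsilon> mark B =
     ennreal (1 / \<mu>) *
     (\<integral>\<^sup>+ \<omega>. (\<Sum>\<^sub>\<infinity>z\<in>\<Upsilon> \<omega>. indicator {0..1} z * indicator B (mark \<omega> z)) \<partial>M)"

end

theory Submission
  imports Defs
begin

text \<open>
  Almost surely, the points of \<open>\<Upsilon>\<close> correspond bijectively to the pairs \<open>(X, Y)\<close> of points of \<open>\<Phi>\<close>,
  ordered by first coordinate, such that the open ball centred at the axis point \<open>Z\<close> equidistant from
  \<open>X\<close> and \<open>Y\<close>, with radius \<open>|X - Z|\<close>, contains no point of \<open>\<Phi>\<close>. The two-point Mecke formula hence
  turns the Palm expectation into an integral over \<open>\<real>\<^sup>3 \<times> \<real>\<^sup>3\<close> of \<open>exp (- 4/3 \<pi> \<lambda> r\<^sup>3)\<close> with \<open>r = |X - Z|\<close>.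
  In terms of \<open>D = Y - X\<close> and the midpoint \<open>m\<close>, the position of \<open>Z\<close> is a translate of the first coordinate
  of \<open>m\<close> and integrates to 1 over the unit window. What is left depends only on \<open>w = |D|\<^sup>2 / 4\<close> and on
  \<open>s = |m - Z|\<^sup>2\<close>, a quadratic form in the other two coordinates of \<open>m\<close>, with \<open>r\<^sup>2 = s + w\<close> and
  \<open>sin\<^sup>2 (\<alpha> / 2) = w / (s + w)\<close> for the unoriented angle \<open>\<alpha>\<close>. The image of the measure under \<open>(s, w)\<close> has
  density proportional to \<open>sqrt w\<close>, so that \<open>r\<close> and \<open>\<alpha>\<close> separate. The reflection \<open>m - Z \<mapsto> -(m - Z)\<close>
  reverses the orientation and gives the symmetry \<open>t \<mapsto> 2 \<pi> - t\<close>.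
\<close>

subsection \<open>Moment formulas for the Poisson process\<close>

text \<open>The process is known only through its counts in bounded Borel sets, so the two-point
  formula has to be built from these. Of the Poisson law, the mean count, the void probability and
  the independence over disjoint sets are used. Independence handles pairs taken from two disjoint
  windows and a void region that is fixed in advance; hence the passage to all pairs of distinct
  points by a countable cover of the complement of the diagonal, and to balls that vary with the
  pair by discretisation. Counts are taken in \<open>ennreal\<close> through \<open>cnt\<close>, so
  that countable additivity and monotone limits come from measure theory. The direction
  \<open>u\<close> can be any nonzero vector because the two orientations of the angle are averaged;
  the vectors \<open>D\<close> parallel to \<open>u\<close>, where the average breaks down, form a
  null set. The factor 3/4 is the reciprocal of the integral of |cos (t/2)| sin^2 (t/2) over (0, 2
  pi).\<close>

abbreviation cnt :: "'a set \<Rightarrow> ennreal" where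
  "cnt T \<equiv> emeasure (count_space UNIV) T"

lemma cnt_Times: "cnt (S \<times> T) = cnt S * cnt T" if "finite S" "finite T"
  using that by (simp add: emeasure_count_space_finite card_cartesian_product)

lemma emeasure_lborel_Times:
  fixes A :: "'a::euclidean_space set" and B :: "'b::euclidean_space set"
  assumes "A \<in> sets borel" "B \<in> sets borel"
  shows "emeasure lborel (A \<times> B) = emeasure lborel A * emeasure lborel B"
  using assms by (simp add: lborel.emeasure_pair_measure_Times flip: lborel_prod)

text \<open>Uniqueness of finite measures, proved together with the measurability of the weighted count.\<close>

lemma nn_integral_cnt_generator:
  fixes T :: "'w \<Rightarrow> 'a set" and w :: "'w \<Rightarrow> ennreal"
  assumes G: "Int_stable G" "UNIV \<in> G" "sets N = sigma_sets UNIV G"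
    and fin: "\<And>\<omega>. \<omega> \<in> space M \<Longrightarrow> finite (T \<omega>)" "\<And>\<omega>. \<omega> \<in> space M \<Longrightarrow> w \<omega> \<noteq> \<infinity>"
      "emeasure N UNIV \<noteq> \<infinity>"
    and meas: "\<And>A. A \<in> G \<Longrightarrow> (\<lambda>\<omega>. cnt (T \<omega> \<inter> A) * w \<omega>) \<in> borel_measurable M"
    and eq: "\<And>A. A \<in> G \<Longrightarrow> (\<integral>\<^sup>+\<omega>. cnt (T \<omega> \<inter> A) * w \<omega> \<partial>M) = emeasure N A"
    and C: "C \<in> sets N"
  shows "(\<lambda>\<omega>. cnt (T \<omega> \<inter> C) * w \<omega>) \<in> borel_measurable M"
    and "(\<integral>\<^sup>+\<omega>. cnt (T \<omega> \<inter> C) * w \<omega> \<partial>M) = emeasure N C"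
proof -
  have sp: "space N = UNIV"
    using sets_eq_imp_space_eq[of N "sigma UNIV G"] G(3) by simp
  have UN: "UNIV \<in> sets N" using G(2,3) by (auto intro: sigma_sets.Basic)
  define P where "P C \<longleftrightarrow> (\<lambda>\<omega>. cnt (T \<omega> \<inter> C) * w \<omega>) \<in> borel_measurable M \<and>
    (\<integral>\<^sup>+\<omega>. cnt (T \<omega> \<inter> C) * w \<omega> \<partial>M) = emeasure N C" for C
  note G(1)
  moreover have "G \<subseteq> Pow UNIV" by simp
  moreover have "C \<in> sigma_sets UNIV G" using C G(3) by simp
  ultimately have "P C"
  proof (induction rule: sigma_sets_induct_disjoint[consumes 3, case_names basic empty compl union])
    case (basic A)
    then show ?case using meas eq by (simp add: P_def)
  next
    case empty
    show ?case by (simp add: P_def)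
  next
    case (compl A)
    have [measurable]: "(\<lambda>\<omega>. cnt (T \<omega> \<inter> UNIV) * w \<omega>) \<in> borel_measurable M"
      "(\<lambda>\<omega>. cnt (T \<omega> \<inter> A) * w \<omega>) \<in> borel_measurable M"
      using meas[OF G(2)] compl by (auto simp: P_def)
    have *: "cnt (T \<omega> \<inter> (UNIV - A)) * w \<omega> = cnt (T \<omega> \<inter> UNIV) * w \<omega> - cnt (T \<omega> \<inter> A) * w \<omega>"
      if \<omega>: "\<omega> \<in> space M" for \<omega>
    proof -
      have "cnt (T \<omega>) = cnt (T \<omega> \<inter> (UNIV - A)) + cnt (T \<omega> \<inter> A)"
        by (subst plus_emeasure) (auto intro!: arg_cong[where f = cnt])
      \<comment> \<open>Subtraction in \<open>ennreal\<close> undoes addition only for a finite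
        subtrahend; finiteness of \<open>T\<close> and of the weight enters here.\<close>
      moreover have "cnt (T \<omega> \<inter> A) * w \<omega> \<noteq> \<infinity>"
        using fin(1)[OF \<omega>] fin(2)[OF \<omega>]
        by (simp add: emeasure_count_space_finite ennreal_mult_eq_top_iff)
      ultimately show ?thesis by (simp add: distrib_right)
    qed
    have "(\<integral>\<^sup>+\<omega>. cnt (T \<omega> \<inter> (UNIV - A)) * w \<omega> \<partial>M)
        = (\<integral>\<^sup>+\<omega>. cnt (T \<omega> \<inter> UNIV) * w \<omega> - cnt (T \<omega> \<inter> A) * w \<omega> \<partial>M)"
      by (intro nn_integral_cong *)
    also have "\<dots> = (\<integral>\<^sup>+\<omega>. cnt (T \<omega> \<inter> UNIV) * w \<omega> \<partial>M) - (\<integral>\<^sup>+\<omega>. cnt (T \<omega> \<inter> A) * w \<omega> \<partial>M)"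
    proof (intro nn_integral_diff)
      have "emeasure N A \<le> emeasure N UNIV" by (intro emeasure_mono UN) auto
      then show "(\<integral>\<^sup>+\<omega>. cnt (T \<omega> \<inter> A) * w \<omega> \<partial>M) \<noteq> \<infinity>"
        using compl(2) fin(3) by (auto simp: P_def top_unique)
      show "AE \<omega> in M. cnt (T \<omega> \<inter> A) * w \<omega> \<le> cnt (T \<omega> \<inter> UNIV) * w \<omega>"
        by (intro AE_I2 mult_right_mono emeasure_mono) auto
    qed measurable
    also have "\<dots> = emeasure N UNIV - emeasure N A"
      using eq[OF G(2)] compl by (simp add: P_def)
    also have "\<dots> = emeasure N (UNIV - A)"
      using compl(1) G(3) fin(3) UN emeasure_mono[OF subset_UNIV UN, of A]
      by (intro emeasure_Diff[symmetric]) (auto simp: top_unique)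
    finally have "(\<integral>\<^sup>+\<omega>. cnt (T \<omega> \<inter> (UNIV - A)) * w \<omega> \<partial>M) = emeasure N (UNIV - A)" .
    moreover have "(\<lambda>\<omega>. cnt (T \<omega> \<inter> UNIV) * w \<omega> - cnt (T \<omega> \<inter> A) * w \<omega>) \<in> borel_measurable M"
      by measurable
    then have "(\<lambda>\<omega>. cnt (T \<omega> \<inter> (UNIV - A)) * w \<omega>) \<in> borel_measurable M"
      by (rule measurable_cong[THEN iffD2, rotated]) (rule *)
    ultimately show ?case by (simp add: P_def)
  next
    case (union A)
    have *: "cnt (T \<omega> \<inter> (\<Union>i. A i)) * w \<omega> = (\<Sum>i. cnt (T \<omega> \<inter> A i) * w \<omega>)" for \<omega>
    proof -
      have "cnt (T \<omega> \<inter> (\<Union>i. A i)) = (\<Sum>i. cnt (T \<omega> \<inter> A i))"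
        using union(1) by (subst suminf_emeasure) (auto simp: disjoint_family_on_def)
      then show ?thesis by simp
    qed
    have [measurable]: "(\<lambda>\<omega>. cnt (T \<omega> \<inter> A i) * w \<omega>) \<in> borel_measurable M" for i
      using union(3) by (simp add: P_def)
    have "(\<integral>\<^sup>+\<omega>. cnt (T \<omega> \<inter> (\<Union>i. A i)) * w \<omega> \<partial>M) = (\<Sum>i. \<integral>\<^sup>+\<omega>. cnt (T \<omega> \<inter> A i) * w \<omega> \<partial>M)"
      unfolding * by (intro nn_integral_suminf) measurable
    also have "\<dots> = (\<Sum>i. emeasure N (A i))" using union(3) by (simp add: P_def)
    also have "\<dots> = emeasure N (\<Union>i. A i)"
      using union(1,2) G(3) by (intro suminf_emeasure) auto
    finally have "(\<integral>\<^sup>+\<omega>. cnt (T \<omega> \<inter> (\<Union>i. A i)) * w \<omega> \<partial>M) = emeasure N (\<Union>i. A i)" .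
    moreover have "(\<lambda>\<omega>. cnt (T \<omega> \<inter> (\<Union>i. A i)) * w \<omega>) \<in> borel_measurable M"
      unfolding * by measurable
    ultimately show ?case by (simp add: P_def)
  qed
  then show "(\<lambda>\<omega>. cnt (T \<omega> \<inter> C) * w \<omega>) \<in> borel_measurable M"
    and "(\<integral>\<^sup>+\<omega>. cnt (T \<omega> \<inter> C) * w \<omega> \<partial>M) = emeasure N C"
    by (auto simp: P_def)
qed

section \<open>Means, void probabilities and products of counts\<close>

locale stationary_poisson = prob_space M for M :: "'w measure" +
  fixes lam :: real and \<Phi> :: "'w \<Rightarrow> (real^3) set"
  assumes lam_pos: "lam > 0"
    and spp: "stationary_poisson_process M lam \<Phi>"
begin

lemma finite_points: "\<omega> \<in> space M \<Longrightarrow> bounded B \<Longrightarrow> finite (\<Phi> \<omega> \<inter> B)"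
  using spp by (simp add: stationary_poisson_process_def)

lemma card_points_measurable:
  "B \<in> sets borel \<Longrightarrow> bounded B \<Longrightarrow> (\<lambda>\<omega>. card (\<Phi> \<omega> \<inter> B)) \<in> measurable M (count_space UNIV)"
  using spp by (simp add: stationary_poisson_process_def)

lemma prob_card_points:
  "B \<in> sets borel \<Longrightarrow> bounded B \<Longrightarrow> prob {\<omega>\<in>space M. card (\<Phi> \<omega> \<inter> B) = k} =
     (lam * measure lborel B) ^ k / fact k * exp (- (lam * measure lborel B))"
  using spp by (simp add: stationary_poisson_process_def)

lemma emeasure_lborel_bounded: "bounded (B :: (real^3) set) \<Longrightarrow> B \<in> sets borel \<Longrightarrow>
    emeasure lborel B = ennreal (measure lborel B)"
  using emeasure_bounded_finite[of B] by (simp add: emeasure_eq_ennreal_measure)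

lemma nn_integral_card_points:
  assumes B: "B \<in> sets borel" "bounded B"
  shows "(\<integral>\<^sup>+\<omega>. of_nat (card (\<Phi> \<omega> \<inter> B)) \<partial>M) = ennreal lam * emeasure lborel B"
proof -
  define N where "N \<omega> = card (\<Phi> \<omega> \<inter> B)" for \<omega>
  define a where "a = lam * measure lborel B"
  have a: "a \<ge> 0" using lam_pos by (simp add: a_def)
  have [measurable]: "N \<in> measurable M (count_space UNIV)"
    using card_points_measurable[OF B] by (simp add: N_def[abs_def])
  have mN: "(\<lambda>\<omega>. f (N \<omega>)) \<in> borel_measurable M" for f :: "nat \<Rightarrow> ennreal"
    by (rule measurable_compose[where N = "count_space UNIV"]) auto
  have *: "(of_nat n :: ennreal) = (\<Sum>k. of_nat k * indicator {k} n)" for n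
    by (subst suminf_finite[of "{n}"]) (auto simp: indicator_def)
  have "(\<integral>\<^sup>+\<omega>. of_nat (N \<omega>) \<partial>M) = (\<integral>\<^sup>+\<omega>. (\<Sum>k. of_nat k * indicator {k} (N \<omega>)) \<partial>M)"
    by (subst *) simp
  also have "\<dots> = (\<Sum>k. \<integral>\<^sup>+\<omega>. of_nat k * indicator {k} (N \<omega>) \<partial>M)"
    by (intro nn_integral_suminf mN)
  also have "\<dots> = (\<Sum>k. ennreal (real k * (a ^ k / fact k * exp (- a))))"
  proof (intro suminf_cong)
    fix k
    have "(\<integral>\<^sup>+\<omega>. of_nat k * indicator {k} (N \<omega>) \<partial>M)
        = (\<integral>\<^sup>+\<omega>. of_nat k * indicator {\<omega>\<in>space M. N \<omega> = k} \<omega> \<partial>M)"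
      by (intro nn_integral_cong) (auto simp: indicator_def)
    also have "\<dots> = of_nat k * emeasure M {\<omega>\<in>space M. N \<omega> = k}"
      by (intro nn_integral_cmult_indicator) measurable
    also have "\<dots> = ennreal (real k * (a ^ k / fact k * exp (- a)))"
      using prob_card_points[OF B, of k] a
      by (simp add: emeasure_eq_measure N_def a_def ennreal_of_nat_eq_real_of_nat flip: ennreal_mult'')
    finally show "(\<integral>\<^sup>+\<omega>. of_nat k * indicator {k} (N \<omega>) \<partial>M)
       = ennreal (real k * (a ^ k / fact k * exp (- a)))" .
  qed
  also have "\<dots> = ennreal a"
  proof (rule suminf_ennreal_eq)
    show "real k * (a ^ k / fact k * exp (- a)) \<ge> 0" for k using a by simp
    have "(\<lambda>k. a ^ k / fact k) sums exp a"
      using exp_converges[of a] by (simp add: divide_inverse mult.commute scaleR_conv_of_real)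
    then have "(\<lambda>k. a * exp (- a) * (a ^ k / fact k)) sums (a * exp (- a) * exp a)"
      by (rule sums_mult)
    also have "a * exp (- a) * exp a = a" by (simp add: mult.assoc flip: exp_add)
    \<comment> \<open>The term of index k + 1 of the mean is \<open>a\<close> times the k-th Poisson
      weight, and the term of index 0 vanishes.\<close>
    also have "(\<lambda>k. a * exp (- a) * (a ^ k / fact k)) = (\<lambda>k. real (Suc k) * (a ^ Suc k / fact (Suc k) * exp (- a)))"
      by (intro ext) (simp add: field_simps del: of_nat_Suc)
    finally have "(\<lambda>k. real (Suc k) * (a ^ Suc k / fact (Suc k) * exp (- a))) sums a" .
    then show "(\<lambda>k. real k * (a ^ k / fact k * exp (- a))) sums a"
      by (subst (asm) sums_Suc_iff) simp
  qed
  finally show ?thesis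
    using lam_pos emeasure_lborel_bounded[OF B(2,1)]
    by (simp add: N_def a_def ennreal_mult)
qed

lemma nn_integral_void:
  assumes B: "B \<in> sets borel" "bounded B"
  shows "(\<integral>\<^sup>+\<omega>. indicator {0} (card (\<Phi> \<omega> \<inter> B)) \<partial>M) = ennreal (exp (- (lam * measure lborel B)))"
proof -
  note [measurable] = card_points_measurable[OF B]
  have "(\<integral>\<^sup>+\<omega>. indicator {0} (card (\<Phi> \<omega> \<inter> B)) \<partial>M)
      = (\<integral>\<^sup>+\<omega>. indicator {\<omega>\<in>space M. card (\<Phi> \<omega> \<inter> B) = 0} \<omega> \<partial>M)"
    by (intro nn_integral_cong) (auto simp: indicator_def)
  also have "\<dots> = emeasure M {\<omega>\<in>space M. card (\<Phi> \<omega> \<inter> B) = 0}"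
    by (intro nn_integral_indicator) measurable
  finally show ?thesis using prob_card_points[OF B, of 0] by (simp add: emeasure_eq_measure)
qed

lemma nn_integral_prod_card_points:
  fixes A :: "nat \<Rightarrow> (real^3) set" and g :: "nat \<Rightarrow> nat \<Rightarrow> ennreal"
  assumes "finite I" "\<And>i. i \<in> I \<Longrightarrow> A i \<in> sets borel \<and> bounded (A i)" "disjoint_family_on A I"
  shows "(\<integral>\<^sup>+\<omega>. (\<Prod>i\<in>I. g i (card (\<Phi> \<omega> \<inter> A i))) \<partial>M)
       = (\<Prod>i\<in>I. \<integral>\<^sup>+\<omega>. g i (card (\<Phi> \<omega> \<inter> A i)) \<partial>M)"
proof (rule indep_vars_nn_integral)
  have "indep_vars (\<lambda>_. count_space UNIV) (\<lambda>i \<omega>. card (\<Phi> \<omega> \<inter> A i)) I"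
    using spp assms by (simp add: stationary_poisson_process_def)
  then show "indep_vars (\<lambda>_. borel) (\<lambda>i \<omega>. g i (card (\<Phi> \<omega> \<inter> A i))) I"
    by (rule indep_vars_compose2) simp
qed (use assms in auto)

text \<open>The factor \<open>g\<close> of the count in a third region is the indicator of a void event in the
  two-point formula, and the count itself in the three-point formula.\<close>

lemma nn_integral_pairs_disjoint:
  fixes A0 A1 A2 :: "(real^3) set" and g :: "nat \<Rightarrow> ennreal"
  assumes A: "A0 \<in> sets borel" "bounded A0" "A1 \<in> sets borel" "bounded A1"
      "A2 \<in> sets borel" "bounded A2"
    and disj: "A0 \<inter> A1 = {}" "A0 \<inter> A2 = {}" "A1 \<inter> A2 = {}"
    and g: "\<And>n. g n \<noteq> \<infinity>" and C: "C \<in> sets borel"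
    and gI: "(\<integral>\<^sup>+\<omega>. g (card (\<Phi> \<omega> \<inter> A0)) \<partial>M) = c" "c \<noteq> \<infinity>"
  shows "(\<lambda>\<omega>. cnt ((\<Phi> \<omega> \<inter> A1) \<times> (\<Phi> \<omega> \<inter> A2) \<inter> C) * g (card (\<Phi> \<omega> \<inter> A0))) \<in> borel_measurable M"
    and "(\<integral>\<^sup>+\<omega>. cnt ((\<Phi> \<omega> \<inter> A1) \<times> (\<Phi> \<omega> \<inter> A2) \<inter> C) * g (card (\<Phi> \<omega> \<inter> A0)) \<partial>M)
       = ennreal lam ^ 2 * c * emeasure lborel (A1 \<times> A2 \<inter> C)"
proof -
  define G where "G = {a \<times> b |a b. a \<in> sets (borel :: (real^3) measure) \<and> b \<in> sets (borel :: (real^3) measure)}"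
  \<comment> \<open>The right-hand side as a finite measure in \<open>C\<close>. The left-hand side
    is compared with it on rectangles, where the number of pairs factors into counts in disjoint
    regions and independence applies.\<close>
  define N where "N = density lborel (\<lambda>p. ennreal lam ^ 2 * c * indicator (A1 \<times> A2) p)"
  have A12: "A1 \<times> A2 \<in> sets (borel :: ((real^3) \<times> (real^3)) measure)"
    using A by (simp flip: borel_prod)
  have N: "emeasure N C = ennreal lam ^ 2 * c * emeasure lborel (A1 \<times> A2 \<inter> C)"
    if "C \<in> sets borel" for C
    using A12 that unfolding N_def
    by (subst emeasure_density)
       (auto simp: mult.assoc nn_integral_cmult simp flip: indicator_inter_arith)
  have fin: "emeasure lborel (A1 \<times> A2) \<noteq> \<infinity>"
    using A by (intro emeasure_bounded_finite[THEN less_imp_neq] bounded_Times) auto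
  have 1: "Int_stable G"
    unfolding G_def by (rule Int_stable_pair_measure_generator)
  have 2: "UNIV \<in> G" by (auto simp: G_def intro!: exI[of _ UNIV])
  have 3: "sets N = sigma_sets UNIV G"
    unfolding N_def G_def sets_density sets_lborel
    by (subst borel_prod[symmetric]) (simp only: sets_pair_measure space_borel UNIV_Times_UNIV)
  have T: "cnt ((\<Phi> \<omega> \<inter> A1) \<times> (\<Phi> \<omega> \<inter> A2) \<inter> (a \<times> b)) * g (card (\<Phi> \<omega> \<inter> A0))
     = of_nat (card (\<Phi> \<omega> \<inter> (A1 \<inter> a))) * of_nat (card (\<Phi> \<omega> \<inter> (A2 \<inter> b))) * g (card (\<Phi> \<omega> \<inter> A0))"
    if "\<omega> \<in> space M" for a b \<omega>
  proof -
    have "(\<Phi> \<omega> \<inter> A1) \<times> (\<Phi> \<omega> \<inter> A2) \<inter> (a \<times> b) = (\<Phi> \<omega> \<inter> (A1 \<inter> a)) \<times> (\<Phi> \<omega> \<inter> (A2 \<inter> b))"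
      by auto
    moreover have "finite (\<Phi> \<omega> \<inter> (A1 \<inter> a))" "finite (\<Phi> \<omega> \<inter> (A2 \<inter> b))"
      using that A by (auto intro!: finite_points bounded_Int)
    ultimately show ?thesis by (simp add: cnt_Times emeasure_count_space_finite)
  qed
  have m: "(\<lambda>\<omega>. of_nat (card (\<Phi> \<omega> \<inter> (A1 \<inter> a))) * of_nat (card (\<Phi> \<omega> \<inter> (A2 \<inter> b))) * g (card (\<Phi> \<omega> \<inter> A0)))
     \<in> borel_measurable M" if "a \<in> sets borel" "b \<in> sets borel" for a b
    using A that by (intro borel_measurable_times_ennreal measurable_compose[OF card_points_measurable]) auto
  have i: "(\<integral>\<^sup>+\<omega>. of_nat (card (\<Phi> \<omega> \<inter> (A1 \<inter> a))) * of_nat (card (\<Phi> \<omega> \<inter> (A2 \<inter> b))) * g (card (\<Phi> \<omega> \<inter> A0)) \<partial>M)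
    = emeasure N (a \<times> b)" if ab: "a \<in> sets borel" "b \<in> sets borel" for a b
  proof -
    define A' where "A' = (\<lambda>i::nat. if i = 0 then A0 else if i = 1 then A1 \<inter> a else A2 \<inter> b)"
    define g' where "g' = (\<lambda>i::nat. if i = 0 then g else of_nat)"
    have dj: "disjoint_family_on A' {0,1,2}"
      using disj by (auto simp: disjoint_family_on_def A'_def)
    have bd: "A' i \<in> sets borel \<and> bounded (A' i)" for i
      using A ab by (auto simp: A'_def intro: bounded_Int)
    have "(\<integral>\<^sup>+\<omega>. of_nat (card (\<Phi> \<omega> \<inter> (A1 \<inter> a))) * of_nat (card (\<Phi> \<omega> \<inter> (A2 \<inter> b))) * g (card (\<Phi> \<omega> \<inter> A0)) \<partial>M)
      = (\<integral>\<^sup>+\<omega>. (\<Prod>i\<in>{0,1,2}. g' i (card (\<Phi> \<omega> \<inter> A' i))) \<partial>M)"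
      by (simp add: A'_def g'_def mult_ac)
    also have "\<dots> = (\<Prod>i\<in>{0,1,2}. \<integral>\<^sup>+\<omega>. g' i (card (\<Phi> \<omega> \<inter> A' i)) \<partial>M)"
      using dj bd by (intro nn_integral_prod_card_points) auto
    also have "\<dots> = c * ((ennreal lam * emeasure lborel (A1 \<inter> a)) * (ennreal lam * emeasure lborel (A2 \<inter> b)))"
      using nn_integral_card_points[of "A1 \<inter> a"] nn_integral_card_points[of "A2 \<inter> b"] gI bd[of 1] bd[of 2]
      by (simp add: A'_def g'_def)
    also have "\<dots> = ennreal lam ^ 2 * c * (emeasure lborel (A1 \<inter> a) * emeasure lborel (A2 \<inter> b))"
      by (simp add: power2_eq_square mult_ac)
    also have "emeasure lborel (A1 \<inter> a) * emeasure lborel (A2 \<inter> b) = emeasure lborel ((A1 \<inter> a) \<times> (A2 \<inter> b))"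
      using A ab by (intro emeasure_lborel_Times[symmetric]) auto
    also have "(A1 \<inter> a) \<times> (A2 \<inter> b) = A1 \<times> A2 \<inter> (a \<times> b)" by auto
    finally show ?thesis
      using ab by (subst N) (auto simp flip: borel_prod)
  qed
  have f: "finite ((\<Phi> \<omega> \<inter> A1) \<times> (\<Phi> \<omega> \<inter> A2))" if "\<omega> \<in> space M" for \<omega>
    using that A by (auto intro!: finite_points)
  have G': "(\<lambda>\<omega>. cnt ((\<Phi> \<omega> \<inter> A1) \<times> (\<Phi> \<omega> \<inter> A2) \<inter> X) * g (card (\<Phi> \<omega> \<inter> A0))) \<in> borel_measurable M"
    "(\<integral>\<^sup>+\<omega>. cnt ((\<Phi> \<omega> \<inter> A1) \<times> (\<Phi> \<omega> \<inter> A2) \<inter> X) * g (card (\<Phi> \<omega> \<inter> A0)) \<partial>M) = emeasure N X"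
    if "X \<in> G" for X
  proof -
    from that obtain a b where X: "X = a \<times> b" "a \<in> sets borel" "b \<in> sets borel"
      by (auto simp: G_def)
    show "(\<lambda>\<omega>. cnt ((\<Phi> \<omega> \<inter> A1) \<times> (\<Phi> \<omega> \<inter> A2) \<inter> X) * g (card (\<Phi> \<omega> \<inter> A0))) \<in> borel_measurable M"
      using m[OF X(2,3)] unfolding X(1) by (rule measurable_cong[THEN iffD1, rotated]) (simp add: T)
    show "(\<integral>\<^sup>+\<omega>. cnt ((\<Phi> \<omega> \<inter> A1) \<times> (\<Phi> \<omega> \<inter> A2) \<inter> X) * g (card (\<Phi> \<omega> \<inter> A0)) \<partial>M) = emeasure N X"
      unfolding X(1) i[OF X(2,3), symmetric] by (intro nn_integral_cong T)
  qed
  have 4: "emeasure N UNIV \<noteq> \<infinity>"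
    using N[of UNIV] fin gI(2) by (simp add: ennreal_mult_eq_top_iff power_eq_top_ennreal)
  have CN: "C \<in> sets N" using C by (simp add: N_def)
  show "(\<lambda>\<omega>. cnt ((\<Phi> \<omega> \<inter> A1) \<times> (\<Phi> \<omega> \<inter> A2) \<inter> C) * g (card (\<Phi> \<omega> \<inter> A0))) \<in> borel_measurable M"
    by (rule nn_integral_cnt_generator(1)[OF 1 2 3 f g 4 G' CN])
  have "(\<integral>\<^sup>+\<omega>. cnt ((\<Phi> \<omega> \<inter> A1) \<times> (\<Phi> \<omega> \<inter> A2) \<inter> C) * g (card (\<Phi> \<omega> \<inter> A0)) \<partial>M) = emeasure N C"
    by (rule nn_integral_cnt_generator(2)[OF 1 2 3 f g 4 G' CN])
  then show "(\<integral>\<^sup>+\<omega>. cnt ((\<Phi> \<omega> \<inter> A1) \<times> (\<Phi> \<omega> \<inter> A2) \<inter> C) * g (card (\<Phi> \<omega> \<inter> A0)) \<partial>M)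
       = ennreal lam ^ 2 * c * emeasure lborel (A1 \<times> A2 \<inter> C)"
    using N[OF C] by simp
qed

text \<open>The expected number of triples in \<open>C\<close> is \<open>lam\<close>^3 times the
  volume of \<open>C\<close> inside the windows, hence zero. Triples are treated as a point and a
  pair: on a product \<open>a\<close> x \<open>b\<close> the count of triples is a count of pairs
  weighted by the count in \<open>A0\<close> cut with \<open>a\<close>.\<close>

lemma AE_no_null_triple_disjoint:
  fixes A0 A1 A2 :: "(real^3) set"
  assumes A: "A0 \<in> sets borel" "bounded A0" "A1 \<in> sets borel" "bounded A1"
      "A2 \<in> sets borel" "bounded A2"
    and disj: "A0 \<inter> A1 = {}" "A0 \<inter> A2 = {}" "A1 \<inter> A2 = {}"
    and C: "C \<in> null_sets (lborel :: ((real^3) \<times> (real^3) \<times> (real^3)) measure)"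
  shows "AE \<omega> in M. \<forall>W\<in>\<Phi> \<omega> \<inter> A0. \<forall>X\<in>\<Phi> \<omega> \<inter> A1. \<forall>Y\<in>\<Phi> \<omega> \<inter> A2. (W, X, Y) \<notin> C"
proof -
  define T where "T \<omega> = (\<Phi> \<omega> \<inter> A0) \<times> ((\<Phi> \<omega> \<inter> A1) \<times> (\<Phi> \<omega> \<inter> A2))" for \<omega>
  define G where "G = {a \<times> b |a b. a \<in> sets (borel :: (real^3) measure) \<and> b \<in> sets (borel :: ((real^3) \<times> (real^3)) measure)}"
  define N where "N = density lborel (\<lambda>p. ennreal lam ^ 3 * indicator (A0 \<times> (A1 \<times> A2)) p)"
  have A12: "A1 \<times> A2 \<in> sets (borel :: ((real^3) \<times> (real^3)) measure)"
    using A by (simp flip: borel_prod)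
  have A012: "A0 \<times> (A1 \<times> A2) \<in> sets (borel :: ((real^3) \<times> (real^3) \<times> (real^3)) measure)"
    using A A12 by (subst borel_prod[symmetric]) auto
  have N: "emeasure N C = ennreal lam ^ 3 * emeasure lborel (A0 \<times> (A1 \<times> A2) \<inter> C)"
    if "C \<in> sets borel" for C
    using A012 that unfolding N_def
    by (subst emeasure_density)
       (auto simp: mult.assoc nn_integral_cmult simp flip: indicator_inter_arith)
  have fin: "emeasure lborel (A0 \<times> (A1 \<times> A2)) \<noteq> \<infinity>"
    using A by (intro emeasure_bounded_finite[THEN less_imp_neq] bounded_Times) auto
  have 1: "Int_stable G"
    unfolding G_def by (rule Int_stable_pair_measure_generator)
  have 2: "UNIV \<in> G" by (auto simp: G_def intro!: exI[of _ UNIV])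
  have 3: "sets N = sigma_sets UNIV G"
    unfolding N_def G_def sets_density sets_lborel
    by (subst borel_prod[symmetric]) (simp only: sets_pair_measure space_borel UNIV_Times_UNIV)
  have 4: "emeasure N UNIV \<noteq> \<infinity>"
    using N[of UNIV] fin by (simp add: ennreal_mult_eq_top_iff power_eq_top_ennreal)
  have f: "finite (T \<omega>)" if "\<omega> \<in> space M" for \<omega>
    using that A by (auto intro!: finite_points simp: T_def)
  have G': "(\<lambda>\<omega>. cnt (T \<omega> \<inter> X) * 1) \<in> borel_measurable M"
    "(\<integral>\<^sup>+\<omega>. cnt (T \<omega> \<inter> X) * 1 \<partial>M) = emeasure N X"
    if "X \<in> G" for X
  proof -
    from that obtain a b where X: "X = a \<times> b" "a \<in> sets borel" "b \<in> sets borel"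
      by (auto simp: G_def)
    have T: "cnt (T \<omega> \<inter> X) * 1
        = cnt ((\<Phi> \<omega> \<inter> A1) \<times> (\<Phi> \<omega> \<inter> A2) \<inter> b) * of_nat (card (\<Phi> \<omega> \<inter> (A0 \<inter> a)))"
      if "\<omega> \<in> space M" for \<omega>
    proof -
      have "T \<omega> \<inter> X = (\<Phi> \<omega> \<inter> (A0 \<inter> a)) \<times> ((\<Phi> \<omega> \<inter> A1) \<times> (\<Phi> \<omega> \<inter> A2) \<inter> b)"
        by (auto simp: T_def X)
      moreover have "finite (\<Phi> \<omega> \<inter> (A0 \<inter> a))" "finite ((\<Phi> \<omega> \<inter> A1) \<times> (\<Phi> \<omega> \<inter> A2))"
        using that A by (auto intro!: finite_points bounded_Int)
      ultimately show ?thesis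
        by (simp add: cnt_Times emeasure_count_space_finite mult.commute)
    qed
    have A0a: "A0 \<inter> a \<in> sets borel" "bounded (A0 \<inter> a)" using A X by (auto intro: bounded_Int)
    have dj: "A0 \<inter> a \<inter> A1 = {}" "A0 \<inter> a \<inter> A2 = {}" using disj by auto
    have ne: "ennreal lam * emeasure lborel (A0 \<inter> a) \<noteq> \<infinity>"
      using emeasure_bounded_finite[OF A0a(2)] by (simp add: ennreal_mult_eq_top_iff)
    \<comment> \<open>The weight \<open>g\<close> is \<open>of_nat\<close> here; its mean supplies
      the third factor of \<open>lam\<close>.\<close>
    note * = nn_integral_pairs_disjoint[OF A0a A(3-6) dj disj(3) _ X(3) nn_integral_card_points[OF A0a] ne]
    show "(\<lambda>\<omega>. cnt (T \<omega> \<inter> X) * 1) \<in> borel_measurable M"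
      using *(1) by (subst measurable_cong[OF T]) auto
    have "(\<integral>\<^sup>+\<omega>. cnt (T \<omega> \<inter> X) * 1 \<partial>M)
      = ennreal lam ^ 2 * (ennreal lam * emeasure lborel (A0 \<inter> a)) * emeasure lborel (A1 \<times> A2 \<inter> b)"
      using *(2) by (subst nn_integral_cong[OF T]) auto
    also have "\<dots> = ennreal lam ^ 3 * (emeasure lborel (A0 \<inter> a) * emeasure lborel (A1 \<times> A2 \<inter> b))"
      by (simp add: power2_eq_square power3_eq_cube mult_ac)
    also have "emeasure lborel (A0 \<inter> a) * emeasure lborel (A1 \<times> A2 \<inter> b)
        = emeasure lborel ((A0 \<inter> a) \<times> (A1 \<times> A2 \<inter> b))"
      using A A12 X by (intro emeasure_lborel_Times[symmetric]) auto
    also have "(A0 \<inter> a) \<times> (A1 \<times> A2 \<inter> b) = A0 \<times> (A1 \<times> A2) \<inter> X" by (auto simp: X)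
    also have "X \<in> sets borel" using X by (subst borel_prod[symmetric]) auto
    note N[OF this, symmetric]
    finally show "(\<integral>\<^sup>+\<omega>. cnt (T \<omega> \<inter> X) * 1 \<partial>M) = emeasure N X" .
  qed
  have CN: "C \<in> sets N" "C \<in> sets borel" using C by (auto simp: N_def null_sets_def)
  note * = nn_integral_cnt_generator[where T = T and w = "\<lambda>_. 1", OF 1 2 3 f _ 4 G' CN(1)]
  have "emeasure lborel (A0 \<times> (A1 \<times> A2) \<inter> C) = 0"
    using null_set_Int1[of C lborel "A0 \<times> A1 \<times> A2"] C A012 by (simp add: Int_commute null_sets_def)
  then have "(\<integral>\<^sup>+\<omega>. cnt (T \<omega> \<inter> C) \<partial>M) = 0"
    using *(2) N[OF CN(2)] by simp
  moreover have "(\<lambda>\<omega>. cnt (T \<omega> \<inter> C)) \<in> borel_measurable M" using *(1) by simp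
  ultimately have "AE \<omega> in M. cnt (T \<omega> \<inter> C) = 0" by (subst (asm) nn_integral_0_iff_AE) auto
  then show ?thesis
    by eventually_elim (auto simp: T_def emeasure_count_space_eq_0)
qed

end

section \<open>Balls, and separation of points by countably many sets\<close>

lemma measure_ball_3: "measure lborel (ball (c :: real^3) r) = 4 / 3 * pi * max 0 r ^ 3"
proof (cases "r \<ge> 0")
  case True
  then show ?thesis by (simp add: content_ball unit_ball_vol_numeral fact_numeral)
next
  case False
  then show ?thesis by (simp add: ball_empty)
qed

lemma SUP_mult_indicator: "(SUP n. c * indicator (A n) x) = c * (indicator (\<Union>n. A n) x :: ennreal)"
proof (cases "x \<in> (\<Union>n. A n)")
  case True
  then obtain m where "x \<in> A m" by auto
  then show ?thesis
    by (intro antisym SUP_least SUP_upper2[of m]) (auto simp: indicator_def)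
qed (auto simp: indicator_def)

lemma norm_axis_real: "norm (axis i x :: real^'n) = \<bar>x\<bar>"
proof -
  have "(axis i x :: real^'n) = x *\<^sub>R axis i 1" by (simp add: vec_eq_iff axis_def)
  then show ?thesis by simp
qed

lemma subset_ball_shift: "ball x e \<subseteq> ball y e'" if "e + dist y x \<le> e'"
proof
  fix w assume "w \<in> ball x e"
  then show "w \<in> ball y e'" using that dist_triangle[of y w x] by simp
qed

lemma separating_basis_sets:
  fixes \<B> :: "'a::metric_space set set"
  assumes B: "topological_basis \<B>" and "e > 0"
  obtains U where "U \<in> \<B>" "x \<in> U" "U \<subseteq> ball x e"
  using topological_basisE[OF B open_ball, of x x e] assms by auto

text \<open>Distinct points have disjoint bounded neighbourhoods in a countable basis. The cover
  carries formulas for disjoint windows over to all pairs of distinct points.\<close>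

lemma offdiagonal_cover:
  obtains U V :: "nat \<Rightarrow> 'a::euclidean_space set"
  where "\<And>i. open (U i)" "\<And>i. bounded (U i)" "\<And>i. open (V i)" "\<And>i. bounded (V i)"
    "\<And>i. U i \<inter> V i = {}" "(\<Union>i. U i \<times> V i) = {p. fst p \<noteq> snd p}"
proof -
  obtain \<B> :: "'a set set" where B: "countable \<B>" "topological_basis \<B>"
    using ex_countable_basis by blast
  define S where "S = {(U, V) \<in> \<B> \<times> \<B>. bounded U \<and> bounded V \<and> U \<inter> V = {}}"
  have cS: "countable S"
    using B(1) by (auto simp: S_def intro: countable_subset[of _ "\<B> \<times> \<B>"])
  have ex: "\<exists>(U, V)\<in>S. x \<in> U \<and> y \<in> V" if "x \<noteq> y" for x y
  proof -
    have e: "dist x y / 2 > 0" using that by simp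
    obtain U where U: "U \<in> \<B>" "x \<in> U" "U \<subseteq> ball x (dist x y / 2)"
      using separating_basis_sets[OF B(2) e] by blast
    obtain V where V: "V \<in> \<B>" "y \<in> V" "V \<subseteq> ball y (dist x y / 2)"
      using separating_basis_sets[OF B(2) e] by blast
    have "U \<inter> V = {}"
      using U(3) V(3) dist_triangle_half_l[of x _ "dist x y" y] by (fastforce simp: dist_commute)
    then show ?thesis
      using U V bounded_subset[OF bounded_ball U(3)] bounded_subset[OF bounded_ball V(3)]
      by (auto simp: S_def)
  qed
  \<comment> \<open>\<open>from_nat_into\<close> enumerates exactly \<open>S\<close> only when
    \<open>S\<close> is nonempty; a basis vector and \<open>0\<close> are two distinct points to
    separate.\<close>
  obtain b :: 'a where "b \<in> Basis" using nonempty_Basis by blast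
  then have "S \<noteq> {}" using ex[of b 0] nonzero_Basis by auto
  define F where "F = from_nat_into S"
  have F: "range F = S" using range_from_nat_into[OF \<open>S \<noteq> {}\<close> cS] by (simp add: F_def)
  have FS: "F i \<in> S" for i using F by auto
  show thesis
  proof (rule that[of "\<lambda>i. fst (F i)" "\<lambda>i. snd (F i)"])
    fix i
    show "open (fst (F i))" "open (snd (F i))"
      using FS[of i] topological_basis_open[OF B(2)] by (auto simp: S_def split: prod.splits)
    show "bounded (fst (F i))" "bounded (snd (F i))" "fst (F i) \<inter> snd (F i) = {}"
      using FS[of i] by (auto simp: S_def split: prod.splits)
  next
    have "(\<Union>i. fst (F i) \<times> snd (F i)) = (\<Union>q\<in>S. fst q \<times> snd q)"
      unfolding F[symmetric] by blast
    also have "\<dots> = {p. fst p \<noteq> snd p}"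
      using ex by (fastforce simp: S_def)
    finally show "(\<Union>i. fst (F i) \<times> snd (F i)) = {p. fst p \<noteq> snd p}" .
  qed
qed

section \<open>Pairs and triples from the whole space, and pairs with an empty ball\<close>

context stationary_poisson
begin

text \<open>\<open>C\<close> is cut into countably many disjoint pieces, each inside a product of
  disjoint windows. Since the points of a pair in \<open>C\<close> avoid \<open>K\<close>, removing
  \<open>K\<close> from the windows loses no pair and makes their counts independent of the void
  event.\<close>

lemma pairs_void:
  assumes C: "C \<in> sets (borel :: ((real^3) \<times> (real^3)) measure)" "\<And>p. p \<in> C \<Longrightarrow> fst p \<noteq> snd p"
    and K: "K \<in> sets borel" "bounded K" "\<And>p. p \<in> C \<Longrightarrow> fst p \<notin> K \<and> snd p \<notin> K"
  shows "(\<lambda>\<omega>. cnt (\<Phi> \<omega> \<times> \<Phi> \<omega> \<inter> C) * indicator {0} (card (\<Phi> \<omega> \<inter> K))) \<in> borel_measurable M"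
    and "(\<integral>\<^sup>+\<omega>. cnt (\<Phi> \<omega> \<times> \<Phi> \<omega> \<inter> C) * indicator {0} (card (\<Phi> \<omega> \<inter> K)) \<partial>M)
      = ennreal lam ^ 2 * ennreal (exp (- (lam * measure lborel K))) * emeasure lborel C"
proof -
  obtain U V :: "nat \<Rightarrow> (real^3) set" where UV: "\<And>i. open (U i)" "\<And>i. bounded (U i)"
    "\<And>i. open (V i)" "\<And>i. bounded (V i)"
    "\<And>i. U i \<inter> V i = {}" "(\<Union>i. U i \<times> V i) = {p. fst p \<noteq> snd p}"
    using offdiagonal_cover by blast
  define D where "D i = disjointed (\<lambda>i. U i \<times> V i) i \<inter> C" for i
  have D: "D i \<in> sets borel" for i
  proof -
    have "range (disjointed (\<lambda>i. U i \<times> V i)) \<subseteq> sets borel"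
      using UV by (intro sets.range_disjointed_sets) (auto intro!: borel_open open_Times)
    then show ?thesis unfolding D_def by (intro sets.Int C) auto
  qed
  have Dsub: "D i \<subseteq> U i \<times> V i" "D i \<subseteq> C" for i
    using disjointed_subset[of "\<lambda>i. U i \<times> V i" i] by (auto simp: D_def)
  have Ddj: "disjoint_family D"
    using disjoint_family_disjointed[of "\<lambda>i. U i \<times> V i"] by (auto simp: D_def disjoint_family_on_def)
  have DC: "(\<Union>i. D i) = C"
    using UN_disjointed_eq[of "\<lambda>i. U i \<times> V i"] UV(6) C(2) by (auto simp: D_def)
  let ?g = "indicator {0} :: nat \<Rightarrow> ennreal"
  let ?h = "\<lambda>i \<omega>. cnt ((\<Phi> \<omega> \<inter> (U i - K)) \<times> (\<Phi> \<omega> \<inter> (V i - K)) \<inter> D i) * ?g (card (\<Phi> \<omega> \<inter> K))"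
  have T: "(\<Phi> \<omega> \<inter> (U i - K)) \<times> (\<Phi> \<omega> \<inter> (V i - K)) \<inter> D i = \<Phi> \<omega> \<times> \<Phi> \<omega> \<inter> D i" for \<omega> i
    using Dsub[of i] K(3) by fastforce
  have *: "cnt (\<Phi> \<omega> \<times> \<Phi> \<omega> \<inter> C) * ?g (card (\<Phi> \<omega> \<inter> K)) = (\<Sum>i. ?h i \<omega>)" for \<omega>
  proof -
    have "cnt (\<Phi> \<omega> \<times> \<Phi> \<omega> \<inter> C) = cnt (\<Union>i. \<Phi> \<omega> \<times> \<Phi> \<omega> \<inter> D i)" using DC by (intro arg_cong[where f = cnt]) auto
    also have "\<dots> = (\<Sum>i. cnt (\<Phi> \<omega> \<times> \<Phi> \<omega> \<inter> D i))"
      using Ddj by (subst suminf_emeasure) (auto simp: disjoint_family_on_def)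
    finally show ?thesis by (simp add: T)
  qed
  note p = nn_integral_pairs_disjoint[OF K(1,2) _ _ _ _ _ _ _ _ D nn_integral_void[OF K(1,2)]]
  have bd: "bounded (U i - K)" "bounded (V i - K)" for i
    using bounded_subset[OF UV(2) Diff_subset] bounded_subset[OF UV(4) Diff_subset] by auto
  have UVK: "(U i - K) \<inter> (V i - K) = {}" for i using UV(5)[of i] by blast
  have m [measurable]: "?h i \<in> borel_measurable M" for i
    using UV bd K UVK by (intro p(1)) (auto simp: indicator_def)
  have i: "(\<integral>\<^sup>+\<omega>. ?h i \<omega> \<partial>M) = ennreal lam ^ 2 * ennreal (exp (- (lam * measure lborel K))) * emeasure lborel (D i)" for i
  proof -
    have "(U i - K) \<times> (V i - K) \<inter> D i = D i"
      using Dsub[of i] K(3) by fastforce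
    then show ?thesis using UV bd K UVK by (subst p(2)) (auto simp: indicator_def)
  qed
  show "(\<lambda>\<omega>. cnt (\<Phi> \<omega> \<times> \<Phi> \<omega> \<inter> C) * ?g (card (\<Phi> \<omega> \<inter> K))) \<in> borel_measurable M"
    unfolding * by measurable
  have "(\<integral>\<^sup>+\<omega>. cnt (\<Phi> \<omega> \<times> \<Phi> \<omega> \<inter> C) * ?g (card (\<Phi> \<omega> \<inter> K)) \<partial>M) = (\<Sum>i. \<integral>\<^sup>+\<omega>. ?h i \<omega> \<partial>M)"
    unfolding * by (intro nn_integral_suminf m)
  also have "\<dots> = ennreal lam ^ 2 * ennreal (exp (- (lam * measure lborel K))) * (\<Sum>i. emeasure lborel (D i))"
    unfolding i by simp
  also have "(\<Sum>i. emeasure lborel (D i)) = emeasure lborel C"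
    using D Ddj DC by (subst suminf_emeasure) auto
  finally show "(\<integral>\<^sup>+\<omega>. cnt (\<Phi> \<omega> \<times> \<Phi> \<omega> \<inter> C) * ?g (card (\<Phi> \<omega> \<inter> K)) \<partial>M)
      = ennreal lam ^ 2 * ennreal (exp (- (lam * measure lborel K))) * emeasure lborel C" .
qed

lemma AE_no_null_pair:
  assumes C: "C \<in> null_sets (lborel :: ((real^3) \<times> (real^3)) measure)" "\<And>p. p \<in> C \<Longrightarrow> fst p \<noteq> snd p"
  shows "AE \<omega> in M. \<Phi> \<omega> \<times> \<Phi> \<omega> \<inter> C = {}"
proof -
  have "C \<in> sets borel" using C by auto
  note * = pairs_void[OF this C(2), of "{}"]
  have "(\<integral>\<^sup>+\<omega>. cnt (\<Phi> \<omega> \<times> \<Phi> \<omega> \<inter> C) \<partial>M) = 0" "(\<lambda>\<omega>. cnt (\<Phi> \<omega> \<times> \<Phi> \<omega> \<inter> C)) \<in> borel_measurable M"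
    using * C(1) by auto
  then have "AE \<omega> in M. cnt (\<Phi> \<omega> \<times> \<Phi> \<omega> \<inter> C) = 0" by (subst (asm) nn_integral_0_iff_AE) auto
  then show ?thesis by eventually_elim (simp add: emeasure_count_space_eq_0)
qed

text \<open>Countably many triples of disjoint bounded basis sets separate all triples of distinct
  points, so only countably many exceptional null events arise.\<close>

lemma AE_no_null_triple:
  assumes C: "C \<in> null_sets (lborel :: ((real^3) \<times> (real^3) \<times> (real^3)) measure)"
  shows "AE \<omega> in M. \<forall>W\<in>\<Phi> \<omega>. \<forall>X\<in>\<Phi> \<omega>. \<forall>Y\<in>\<Phi> \<omega>. W \<noteq> X \<longrightarrow> W \<noteq> Y \<longrightarrow> X \<noteq> Y \<longrightarrow> (W, X, Y) \<notin> C"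
proof -
  obtain \<B> :: "(real^3) set set" where B: "countable \<B>" "topological_basis \<B>"
    using ex_countable_basis by blast
  define S where "S = {(U, V, W) \<in> \<B> \<times> \<B> \<times> \<B>. bounded U \<and> bounded V \<and> bounded W
    \<and> U \<inter> V = {} \<and> U \<inter> W = {} \<and> V \<inter> W = {}}"
  have cS: "countable S"
    using B(1) by (auto simp: S_def intro: countable_subset[of _ "\<B> \<times> \<B> \<times> \<B>"])
  have "AE \<omega> in M. \<forall>(U, V, W)\<in>S. \<forall>w\<in>\<Phi> \<omega> \<inter> U. \<forall>x\<in>\<Phi> \<omega> \<inter> V. \<forall>y\<in>\<Phi> \<omega> \<inter> W. (w, x, y) \<notin> C"
    unfolding AE_ball_countable[OF cS] using topological_basis_open[OF B(2)]
    by (auto simp: S_def intro!: AE_no_null_triple_disjoint C)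
  then show ?thesis
  proof (eventually_elim, safe)
    fix \<omega> w x y
    assume *: "\<forall>(U, V, W)\<in>S. \<forall>w\<in>\<Phi> \<omega> \<inter> U. \<forall>x\<in>\<Phi> \<omega> \<inter> V. \<forall>y\<in>\<Phi> \<omega> \<inter> W. (w, x, y) \<notin> C"
      and pts: "w \<in> \<Phi> \<omega>" "x \<in> \<Phi> \<omega>" "y \<in> \<Phi> \<omega>" "w \<noteq> x" "w \<noteq> y" "x \<noteq> y" "(w, x, y) \<in> C"
    define e where "e = min (dist w x) (min (dist w y) (dist x y)) / 2"
    have e: "e > 0" using pts by (simp add: e_def)
    obtain U where U: "U \<in> \<B>" "w \<in> U" "U \<subseteq> ball w e" using separating_basis_sets[OF B(2) e] by blast
    obtain V where V: "V \<in> \<B>" "x \<in> V" "V \<subseteq> ball x e" using separating_basis_sets[OF B(2) e] by blast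
    obtain W where W: "W \<in> \<B>" "y \<in> W" "W \<subseteq> ball y e" using separating_basis_sets[OF B(2) e] by blast
    have dj: "ball a e \<inter> ball b e = {}" if "2 * e \<le> dist a b" for a b :: "real^3"
    proof -
      have False if "dist a y < e" "dist b y < e" for y
        using that \<open>2 * e \<le> dist a b\<close> dist_triangle2[of a b y] by simp
      then show ?thesis by auto
    qed
    have "2 * e \<le> dist w x" "2 * e \<le> dist w y" "2 * e \<le> dist x y"
      by (auto simp: e_def)
    note dj[OF this(1)] dj[OF this(2)] dj[OF this(3)]
    then have "(U, V, W) \<in> S"
      using U V W bounded_subset[OF bounded_ball U(3)] bounded_subset[OF bounded_ball V(3)]
        bounded_subset[OF bounded_ball W(3)]
      by (auto simp: S_def)
    then show False using * pts U(2) V(2) W(2) by blast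
  qed
qed

text \<open>The void event concerns a ball that depends on the pair. It is approximated from inside by the
  balls \<open>K n (\<kappa> n p)\<close>, whose centres and radii lie on a grid of mesh \<open>1/(n+1)\<close>: the pairs split into
  countably many classes on which this ball is constant, and on each class the formula for a fixed
  void region applies. Being interior, the approximating balls avoid the two points themselves.\<close>

lemma pairs_empty_ball_bounded:
  fixes z r :: "(real^3) \<times> (real^3) \<Rightarrow> real"
  assumes C: "C \<in> sets borel" "\<And>p. p \<in> C \<Longrightarrow> fst p \<noteq> snd p" "bounded C"
    and m [measurable]: "z \<in> borel_measurable borel" "r \<in> borel_measurable borel"
    and r: "\<And>p. p \<in> C \<Longrightarrow> r p \<le> dist (x_axis_point (z p)) (fst p)"
      "\<And>p. p \<in> C \<Longrightarrow> r p \<le> dist (x_axis_point (z p)) (snd p)"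
  defines "S \<equiv> \<lambda>\<omega>. {p \<in> C. fst p \<in> \<Phi> \<omega> \<and> snd p \<in> \<Phi> \<omega> \<and> \<Phi> \<omega> \<inter> ball (x_axis_point (z p)) (r p) = {}}"
  shows "(\<lambda>\<omega>. cnt (S \<omega>)) \<in> borel_measurable M"
    and "(\<integral>\<^sup>+\<omega>. cnt (S \<omega>) \<partial>M) = ennreal lam ^ 2 *
      (\<integral>\<^sup>+p. ennreal (exp (- (lam * (4 / 3 * pi * max 0 (r p) ^ 3)))) * indicator C p \<partial>lborel)"
proof -
  note [measurable] = C(1)
  \<comment> \<open>Both grid indices are coded in one natural number, so that the classes can be
    summed by \<open>suminf\<close>.\<close>
  define \<kappa> where "\<kappa> n p = (to_nat (\<lfloor>real (Suc n) * z p\<rfloor>, \<lfloor>real (Suc n) * r p\<rfloor>))" for n p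
  \<comment> \<open>The radius is rounded down and then loses one further mesh
    (\<open>j - 1\<close>), which pays for the rounding of the centre and keeps the grid ball inside
    the true one. It can be negative, whence \<open>max 0\<close> in the volume.\<close>
  define \<rho> where "\<rho> n k = (case from_nat k of (i::int, j::int) \<Rightarrow> (real_of_int j - 1) / real (Suc n))" for n k
  define K where "K n k = (case from_nat k of (i::int, j::int) \<Rightarrow> ball (x_axis_point (i / real (Suc n))) (\<rho> n k))" for n k
  have \<rho>\<kappa>: "\<rho> n (\<kappa> n p) = (real_of_int \<lfloor>real (Suc n) * r p\<rfloor> - 1) / real (Suc n)" for n p
    by (simp add: \<rho>_def \<kappa>_def)
  have K\<kappa>: "K n (\<kappa> n p) = ball (x_axis_point (\<lfloor>real (Suc n) * z p\<rfloor> / real (Suc n))) (\<rho> n (\<kappa> n p))" for n p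
    by (simp add: K_def \<kappa>_def)
  have ax: "dist (x_axis_point a) (x_axis_point b) = \<bar>a - b\<bar>" for a b
  proof -
    have "x_axis_point a - x_axis_point b = axis 1 (a - b)"
      by (simp add: x_axis_point_def vec_eq_iff axis_def)
    then show ?thesis by (simp add: dist_norm norm_axis_real)
  qed
  have fl: "\<bar>real_of_int \<lfloor>real (Suc n) * x\<rfloor> / real (Suc n) - x\<bar> \<le> 1 / real (Suc n)" for n x
  proof -
    have "\<bar>real_of_int \<lfloor>real (Suc n) * x\<rfloor> - real (Suc n) * x\<bar> \<le> 1" by linarith
    moreover have "real_of_int \<lfloor>real (Suc n) * x\<rfloor> / real (Suc n) - x
        = (real_of_int \<lfloor>real (Suc n) * x\<rfloor> - real (Suc n) * x) / real (Suc n)"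
      by (simp add: diff_divide_distrib)
    ultimately show ?thesis
      by (simp only: abs_divide abs_of_nat) (intro divide_right_mono, auto)
  qed
  have K_sub: "K n (\<kappa> n p) \<subseteq> ball (x_axis_point (z p)) (r p)" for n p
  proof -
    have "real_of_int \<lfloor>real (Suc n) * r p\<rfloor> / real (Suc n) \<le> r p"
      by (simp add: divide_le_eq mult.commute)
    then have "\<rho> n (\<kappa> n p) + 1 / real (Suc n) \<le> r p"
      unfolding \<rho>\<kappa> by (simp add: diff_divide_distrib)
    then show ?thesis
      unfolding K\<kappa> using fl[of n "z p"] by (intro subset_ball_shift) (auto simp: ax)
  qed
  have K_bd: "K n k \<in> sets borel" "bounded (K n k)" for n k
    by (auto simp: K_def split: prod.splits)
  have K_vol: "measure lborel (K n k) = 4 / 3 * pi * max 0 (\<rho> n k) ^ 3" for n k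
    by (auto simp: K_def measure_ball_3 split: prod.splits)
  define Cm where "Cm n k = C \<inter> {p. \<kappa> n p = k}" for n k
  have Cm [measurable]: "Cm n k \<in> sets borel" for n k
  proof -
    \<comment> \<open>\<open>to_nat\<close> is injective but may miss numbers; the last conjunct
      says that \<open>k\<close> is a code at all.\<close>
    have "to_nat q = k \<longleftrightarrow> fst q = fst (from_nat k :: int \<times> int) \<and> snd q = snd (from_nat k :: int \<times> int)
        \<and> to_nat (from_nat k :: int \<times> int) = k" for q :: "int \<times> int"
      by (metis from_nat_to_nat prod_eqI)
    note * = this
    have "{p. \<kappa> n p = k} = {p. \<lfloor>real (Suc n) * z p\<rfloor> = fst (from_nat k :: int \<times> int)} \<inter>
       {p. \<lfloor>real (Suc n) * r p\<rfloor> = snd (from_nat k :: int \<times> int)} \<inter> {p. to_nat (from_nat k :: int \<times> int) = k}"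
    proof (intro set_eqI)
      fix p
      show "p \<in> {p. \<kappa> n p = k} \<longleftrightarrow> p \<in> {p. \<lfloor>real (Suc n) * z p\<rfloor> = fst (from_nat k :: int \<times> int)} \<inter>
       {p. \<lfloor>real (Suc n) * r p\<rfloor> = snd (from_nat k :: int \<times> int)} \<inter> {p. to_nat (from_nat k :: int \<times> int) = k}"
        using *[of "(\<lfloor>real (Suc n) * z p\<rfloor>, \<lfloor>real (Suc n) * r p\<rfloor>)"] unfolding \<kappa>_def by simp
    qed
    moreover have "{p. \<lfloor>real (Suc n) * z p\<rfloor> = i} \<in> sets borel" "{p. \<lfloor>real (Suc n) * r p\<rfloor> = i} \<in> sets borel" for i
      by measurable
    ultimately show ?thesis unfolding Cm_def by auto
  qed
  have Cm_dj: "disjoint_family (Cm n)" and Cm_UN: "(\<Union>k. Cm n k) = C" for n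
    by (auto simp: Cm_def disjoint_family_on_def)
  have K_avoid: "fst p \<notin> K n k \<and> snd p \<notin> K n k" if "p \<in> Cm n k" for n k p
    using K_sub[of n p] r[of p] that by (fastforce simp: Cm_def)
  note pv = pairs_void[OF Cm _ K_bd K_avoid]
  have Cm_ne: "p \<in> Cm n k \<Longrightarrow> fst p \<noteq> snd p" for n k p using C(2) by (auto simp: Cm_def)
  define Sn where "Sn n \<omega> = {p \<in> C. fst p \<in> \<Phi> \<omega> \<and> snd p \<in> \<Phi> \<omega> \<and> \<Phi> \<omega> \<inter> K n (\<kappa> n p) = {}}" for n \<omega>
  have cSn: "cnt (Sn n \<omega>) = (\<Sum>k. cnt (\<Phi> \<omega> \<times> \<Phi> \<omega> \<inter> Cm n k) * indicator {0} (card (\<Phi> \<omega> \<inter> K n k)))"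
    if \<omega>: "\<omega> \<in> space M" for n \<omega>
  proof -
    let ?D = "\<lambda>k. if \<Phi> \<omega> \<inter> K n k = {} then \<Phi> \<omega> \<times> \<Phi> \<omega> \<inter> Cm n k else {}"
    have "Sn n \<omega> = (\<Union>k. ?D k)" by (auto simp: Sn_def Cm_def split: if_splits)
    moreover have "disjoint_family ?D" using Cm_dj[of n] by (auto simp: disjoint_family_on_def)
    ultimately have "cnt (Sn n \<omega>) = (\<Sum>k. cnt (?D k))"
      by (subst suminf_emeasure) auto
    also have "\<dots> = (\<Sum>k. cnt (\<Phi> \<omega> \<times> \<Phi> \<omega> \<inter> Cm n k) * indicator {0} (card (\<Phi> \<omega> \<inter> K n k)))"
      using finite_points[OF \<omega> K_bd(2)] by (intro suminf_cong) (auto simp: indicator_def)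
    finally show ?thesis .
  qed
  have Sn_meas [measurable]: "(\<lambda>\<omega>. cnt (Sn n \<omega>)) \<in> borel_measurable M" for n
    using pv(1)[OF Cm_ne] by (subst measurable_cong[OF cSn]) (auto intro!: borel_measurable_suminf)
  have Sn_int: "(\<integral>\<^sup>+\<omega>. cnt (Sn n \<omega>) \<partial>M) = ennreal lam ^ 2 *
      (\<integral>\<^sup>+p. ennreal (exp (- (lam * (4 / 3 * pi * max 0 (\<rho> n (\<kappa> n p)) ^ 3)))) * indicator C p \<partial>lborel)" for n
  proof -
    let ?e = "\<lambda>k. ennreal (exp (- (lam * (4 / 3 * pi * max 0 (\<rho> n k) ^ 3))))"
    have "(\<integral>\<^sup>+\<omega>. cnt (Sn n \<omega>) \<partial>M)
       = (\<integral>\<^sup>+\<omega>. (\<Sum>k. cnt (\<Phi> \<omega> \<times> \<Phi> \<omega> \<inter> Cm n k) * indicator {0} (card (\<Phi> \<omega> \<inter> K n k))) \<partial>M)"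
      by (intro nn_integral_cong cSn)
    also have "\<dots> = (\<Sum>k. \<integral>\<^sup>+\<omega>. cnt (\<Phi> \<omega> \<times> \<Phi> \<omega> \<inter> Cm n k) * indicator {0} (card (\<Phi> \<omega> \<inter> K n k)) \<partial>M)"
      by (intro nn_integral_suminf pv(1)[OF Cm_ne])
    also have "\<dots> = (\<Sum>k. ennreal lam ^ 2 * (?e k * emeasure lborel (Cm n k)))"
      by (intro suminf_cong) (subst pv(2)[OF Cm_ne], auto simp: K_vol mult.assoc)
    also have "\<dots> = ennreal lam ^ 2 * (\<Sum>k. \<integral>\<^sup>+p. ?e k * indicator (Cm n k) p \<partial>lborel)"
      by (simp add: nn_integral_cmult)
    also have "(\<Sum>k. \<integral>\<^sup>+p. ?e k * indicator (Cm n k) p \<partial>lborel) = (\<integral>\<^sup>+p. (\<Sum>k. ?e k * indicator (Cm n k) p) \<partial>lborel)"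
      by (intro nn_integral_suminf[symmetric]) measurable
    also have "\<dots> = (\<integral>\<^sup>+p. ?e (\<kappa> n p) * indicator C p \<partial>lborel)"
    proof (intro nn_integral_cong)
      fix p
      show "(\<Sum>k. ?e k * indicator (Cm n k) p) = ?e (\<kappa> n p) * indicator C p"
        by (subst suminf_finite[of "{\<kappa> n p}"]) (auto simp: Cm_def indicator_def)
    qed
    finally show ?thesis .
  qed
  have \<rho>_lower: "r p - 2 / real (Suc n) \<le> \<rho> n (\<kappa> n p)" for n p
    unfolding \<rho>\<kappa> using fl[of n "r p"] by (simp add: diff_divide_distrib)
  have lim: "(\<lambda>n. cnt (Sn n \<omega>)) \<longlonglongrightarrow> cnt (S \<omega>)" if \<omega>: "\<omega> \<in> space M" for \<omega>
  proof -
    have "eventually (\<lambda>n. \<Phi> \<omega> \<inter> K n (\<kappa> n p) = {} \<longleftrightarrow> \<Phi> \<omega> \<inter> ball (x_axis_point (z p)) (r p) = {}) sequentially" for p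
    proof (cases "\<Phi> \<omega> \<inter> ball (x_axis_point (z p)) (r p) = {}")
      case True
      then show ?thesis using K_sub[of _ p] by (intro always_eventually) blast
    next
      case False
      then obtain x where x: "x \<in> \<Phi> \<omega>" "dist (x_axis_point (z p)) x < r p" by auto
      \<comment> \<open>A point strictly inside the true ball is inside the grid ball as soon as it
        has three meshes to spare: one for the shift of the centre, two for the loss of
        radius.\<close>
      have "(\<lambda>n. 3 * inverse (real (Suc n))) \<longlonglongrightarrow> 3 * 0"
        by (intro tendsto_intros LIMSEQ_inverse_real_of_nat)
      then have "eventually (\<lambda>n. 3 * inverse (real (Suc n)) < r p - dist (x_axis_point (z p)) x) sequentially"
        by (rule order_tendstoD(2)) (use x(2) in simp)
      then show ?thesis
      proof eventually_elim
        case (elim n)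
        have "dist (x_axis_point (\<lfloor>real (Suc n) * z p\<rfloor> / real (Suc n))) x
            \<le> 1 / real (Suc n) + dist (x_axis_point (z p)) x"
          using dist_triangle[of "x_axis_point (\<lfloor>real (Suc n) * z p\<rfloor> / real (Suc n))" x "x_axis_point (z p)"]
            fl[of n "z p"] by (simp only: ax)
        also have "\<dots> < r p - 2 / real (Suc n)" using elim by (simp add: divide_inverse)
        also note \<rho>_lower
        finally have "x \<in> K n (\<kappa> n p)" by (simp only: K\<kappa> mem_ball)
        then show ?case using x by auto
      qed
    qed
    \<comment> \<open>Boundedness of \<open>C\<close> leaves finitely many pairs, so that one
      \<open>n\<close> serves all of them and the counts are eventually equal.\<close>
    moreover have "finite (\<Phi> \<omega> \<times> \<Phi> \<omega> \<inter> C)"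
    proof -
      have "bounded (fst ` C)" "bounded (snd ` C)" using C(3) by (auto intro: bounded_fst bounded_snd)
      then have "finite ((\<Phi> \<omega> \<inter> fst ` C) \<times> (\<Phi> \<omega> \<inter> snd ` C))" using finite_points[OF \<omega>] by blast
      then show ?thesis by (rule finite_subset[rotated]) force
    qed
    ultimately have "eventually (\<lambda>n. \<forall>p\<in>\<Phi> \<omega> \<times> \<Phi> \<omega> \<inter> C. \<Phi> \<omega> \<inter> K n (\<kappa> n p) = {} \<longleftrightarrow> \<Phi> \<omega> \<inter> ball (x_axis_point (z p)) (r p) = {}) sequentially"
      by (intro eventually_ball_finite) auto
    then have "eventually (\<lambda>n. cnt (Sn n \<omega>) = cnt (S \<omega>)) sequentially"
    proof eventually_elim
      case (elim n)
      then have "Sn n \<omega> = S \<omega>" by (auto simp: Sn_def S_def)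
      then show ?case by simp
    qed
    then show ?thesis by (rule tendsto_eventually)
  qed
  show meas [measurable]: "(\<lambda>\<omega>. cnt (S \<omega>)) \<in> borel_measurable M"
  proof -
    have "cnt (S \<omega>) = liminf (\<lambda>n. cnt (Sn n \<omega>))" if "\<omega> \<in> space M" for \<omega>
      using lim_imp_Liminf[OF _ lim[OF that]] by simp
    then show ?thesis by (subst measurable_cong) auto
  qed
  note all = pairs_void[OF C(1,2), of "{}"]
  have [measurable]: "(\<lambda>\<omega>. cnt (\<Phi> \<omega> \<times> \<Phi> \<omega> \<inter> C)) \<in> borel_measurable M" using all(1) by simp
  have finC: "emeasure lborel C < \<infinity>" using C by (intro emeasure_bounded_finite)
  \<comment> \<open>The grid balls need not increase with \<open>n\<close>, so the limits here and
    in \<open>lim2\<close> are taken by domination: by the number of all pairs in \<open>C\<close>,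
    and by the indicator of \<open>C\<close>, both integrable as \<open>C\<close> is
    bounded.\<close>
  have lim1: "(\<lambda>n. \<integral>\<^sup>+\<omega>. cnt (Sn n \<omega>) \<partial>M) \<longlonglongrightarrow> (\<integral>\<^sup>+\<omega>. cnt (S \<omega>) \<partial>M)"
  proof (rule nn_integral_dominated_convergence[where w = "\<lambda>\<omega>. cnt (\<Phi> \<omega> \<times> \<Phi> \<omega> \<inter> C)"])
    show "(\<integral>\<^sup>+\<omega>. cnt (\<Phi> \<omega> \<times> \<Phi> \<omega> \<inter> C) \<partial>M) < \<infinity>"
      using all(2) finC by (simp add: ennreal_mult_less_top power_less_top_ennreal)
    show "AE \<omega> in M. cnt (Sn n \<omega>) \<le> cnt (\<Phi> \<omega> \<times> \<Phi> \<omega> \<inter> C)" for n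
      by (intro AE_I2 emeasure_mono) (auto simp: Sn_def)
  qed (use lim in auto)
  have lim2: "(\<lambda>n. \<integral>\<^sup>+p. ennreal (exp (- (lam * (4 / 3 * pi * max 0 (\<rho> n (\<kappa> n p)) ^ 3)))) * indicator C p \<partial>lborel)
     \<longlonglongrightarrow> (\<integral>\<^sup>+p. ennreal (exp (- (lam * (4 / 3 * pi * max 0 (r p) ^ 3)))) * indicator C p \<partial>lborel)"
  proof (rule nn_integral_dominated_convergence[where w = "indicator C"])
    fix n
    show "(\<lambda>p. ennreal (exp (- (lam * (4 / 3 * pi * max 0 (\<rho> n (\<kappa> n p)) ^ 3)))) * indicator C p) \<in> borel_measurable lborel"
      unfolding \<rho>\<kappa> by measurable
    show "AE p in lborel. ennreal (exp (- (lam * (4 / 3 * pi * max 0 (\<rho> n (\<kappa> n p)) ^ 3)))) * indicator C p \<le> indicator C p"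
      using lam_pos by (intro AE_I2) (auto simp: indicator_def)
  next
    have "(\<lambda>n. \<rho> n (\<kappa> n p)) \<longlonglongrightarrow> r p" for p
    proof (rule tendsto_sandwich)
      have "(\<lambda>n. r p - 2 * inverse (real (Suc n))) \<longlonglongrightarrow> r p - 2 * 0"
        by (intro tendsto_intros LIMSEQ_inverse_real_of_nat)
      then show "(\<lambda>n. r p - 2 / real (Suc n)) \<longlonglongrightarrow> r p" by (simp add: divide_inverse)
      show "(\<lambda>n. r p) \<longlonglongrightarrow> r p" by simp
      have "\<rho> n (\<kappa> n p) \<le> r p" for n
      proof -
        have "real_of_int \<lfloor>real (Suc n) * r p\<rfloor> - 1 \<le> r p * real (Suc n)"
          by (subst mult.commute) linarith
        then show ?thesis unfolding \<rho>\<kappa> by (subst pos_divide_le_eq) auto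
      qed
      then show "eventually (\<lambda>n. \<rho> n (\<kappa> n p) \<le> r p) sequentially" by simp
      show "eventually (\<lambda>n. r p - 2 / real (Suc n) \<le> \<rho> n (\<kappa> n p)) sequentially" using \<rho>_lower by simp
    qed
    then show "AE p in lborel. (\<lambda>n. ennreal (exp (- (lam * (4 / 3 * pi * max 0 (\<rho> n (\<kappa> n p)) ^ 3)))) * indicator C p)
        \<longlonglongrightarrow> ennreal (exp (- (lam * (4 / 3 * pi * max 0 (r p) ^ 3)))) * indicator C p"
      by (intro AE_I2 tendsto_mult_ennreal tendsto_ennrealI tendsto_intros) (auto simp: indicator_def)
  qed (use finC in auto)
  have "(\<lambda>n. \<integral>\<^sup>+\<omega>. cnt (Sn n \<omega>) \<partial>M) \<longlonglongrightarrow> ennreal lam ^ 2 *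
      (\<integral>\<^sup>+p. ennreal (exp (- (lam * (4 / 3 * pi * max 0 (r p) ^ 3)))) * indicator C p \<partial>lborel)"
    unfolding Sn_int by (intro ennreal_tendsto_cmult lim2) (simp add: power_less_top_ennreal)
  with lim1 show "(\<integral>\<^sup>+\<omega>. cnt (S \<omega>) \<partial>M) = ennreal lam ^ 2 *
      (\<integral>\<^sup>+p. ennreal (exp (- (lam * (4 / 3 * pi * max 0 (r p) ^ 3)))) * indicator C p \<partial>lborel)"
    by (rule LIMSEQ_unique)
qed

text \<open>Exhausting \<open>C\<close> by its bounded parts \<open>CR n\<close> removes the
  boundedness; both sides pass to the limit by monotone convergence.\<close>

lemma pairs_empty_ball:
  fixes z r :: "(real^3) \<times> (real^3) \<Rightarrow> real"
  assumes C: "C \<in> sets borel" "\<And>p. p \<in> C \<Longrightarrow> fst p \<noteq> snd p"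
    and m [measurable]: "z \<in> borel_measurable borel" "r \<in> borel_measurable borel"
    and r: "\<And>p. p \<in> C \<Longrightarrow> r p \<le> dist (x_axis_point (z p)) (fst p)"
      "\<And>p. p \<in> C \<Longrightarrow> r p \<le> dist (x_axis_point (z p)) (snd p)"
  defines "S \<equiv> \<lambda>\<omega>. {p \<in> C. fst p \<in> \<Phi> \<omega> \<and> snd p \<in> \<Phi> \<omega> \<and> \<Phi> \<omega> \<inter> ball (x_axis_point (z p)) (r p) = {}}"
  shows "(\<integral>\<^sup>+\<omega>. cnt (S \<omega>) \<partial>M) = ennreal lam ^ 2 *
      (\<integral>\<^sup>+p. ennreal (exp (- (lam * (4 / 3 * pi * max 0 (r p) ^ 3)))) * indicator C p \<partial>lborel)"
proof -
  note [measurable] = C(1)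
  define CR where "CR n = C \<inter> cball 0 (real n)" for n
  define SR where "SR n \<omega> = {p \<in> CR n. fst p \<in> \<Phi> \<omega> \<and> snd p \<in> \<Phi> \<omega> \<and> \<Phi> \<omega> \<inter> ball (x_axis_point (z p)) (r p) = {}}" for n \<omega>
  have CR: "CR n \<in> sets borel" "bounded (CR n)" "CR n \<subseteq> C" for n
    by (auto simp: CR_def intro: bounded_Int)
  note [measurable] = CR(1)
  have CR_UN: "(\<Union>n. CR n) = C"
    by (auto simp: CR_def) (use real_arch_simple in blast)
  have incCR: "incseq CR" by (auto simp: CR_def incseq_def intro: order_trans)
  have S: "(\<Union>n. SR n \<omega>) = S \<omega>" "incseq (\<lambda>n. SR n \<omega>)" for \<omega>
    using CR_UN incCR by (auto simp: S_def SR_def incseq_def)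
  have bd: "(\<lambda>\<omega>. cnt (SR n \<omega>)) \<in> borel_measurable M"
    "(\<integral>\<^sup>+\<omega>. cnt (SR n \<omega>) \<partial>M) = ennreal lam ^ 2 *
      (\<integral>\<^sup>+p. ennreal (exp (- (lam * (4 / 3 * pi * max 0 (r p) ^ 3)))) * indicator (CR n) p \<partial>lborel)" for n
    unfolding SR_def
    by (rule pairs_empty_ball_bounded[OF CR(1) _ CR(2) m]; use CR(3)[of n] C(2) r in blast)+
  note [measurable] = bd(1)
  have "(\<integral>\<^sup>+\<omega>. cnt (S \<omega>) \<partial>M) = (\<integral>\<^sup>+\<omega>. (SUP n. cnt (SR n \<omega>)) \<partial>M)"
    unfolding S(1)[symmetric] using S(2) by (subst SUP_emeasure_incseq) auto
  also have "\<dots> = (SUP n. \<integral>\<^sup>+\<omega>. cnt (SR n \<omega>) \<partial>M)"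
    using S(2) by (intro nn_integral_monotone_convergence_SUP)
      (auto simp: incseq_def le_fun_def intro!: emeasure_mono)
  also have "\<dots> = ennreal lam ^ 2 *
      (SUP n. \<integral>\<^sup>+p. ennreal (exp (- (lam * (4 / 3 * pi * max 0 (r p) ^ 3)))) * indicator (CR n) p \<partial>lborel)"
    unfolding bd(2) by (simp add: SUP_mult_left_ennreal)
  also have "(SUP n. \<integral>\<^sup>+p. ennreal (exp (- (lam * (4 / 3 * pi * max 0 (r p) ^ 3)))) * indicator (CR n) p \<partial>lborel)
     = (\<integral>\<^sup>+p. (SUP n. ennreal (exp (- (lam * (4 / 3 * pi * max 0 (r p) ^ 3)))) * indicator (CR n) p) \<partial>lborel)"
    using incCR by (intro nn_integral_monotone_convergence_SUP[symmetric])
      (auto simp: incseq_def le_fun_def intro!: mult_left_mono split: split_indicator)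
  also have "\<dots> = (\<integral>\<^sup>+p. ennreal (exp (- (lam * (4 / 3 * pi * max 0 (r p) ^ 3)))) * indicator C p \<partial>lborel)"
    unfolding CR_UN[symmetric] SUP_mult_indicator ..
  finally show ?thesis .
qed

end

subsection \<open>Facets met by the axis and empty balls\<close>

text \<open>The point of the axis equidistant from the two points (\<open>0\<close> when their first coordinates agree).\<close>

definition axis_center :: "(real^3) \<times> (real^3) \<Rightarrow> real" where
  "axis_center p = ((norm (snd p))\<^sup>2 - (norm (fst p))\<^sup>2) / (2 * (snd p $ 1 - fst p $ 1))"

lemma dist_axis_point_sq: "(dist (x_axis_point z) X)\<^sup>2 = (norm X)\<^sup>2 - 2 * z * X $ 1 + z\<^sup>2"
  unfolding dist_norm power2_norm_eq_inner
  by (simp add: inner_diff_left inner_diff_right x_axis_point_def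
      inner_axis inner_axis' inner_commute power2_eq_square algebra_simps)

text \<open>The squared distances to \<open>X\<close> and \<open>Y\<close> share the term z^2, so
  equidistance is a linear equation in \<open>z\<close>, with one root because the first coordinates
  differ.\<close>

lemma equidistant_iff:
  assumes "X $ 1 \<noteq> Y $ 1"
  shows "dist (x_axis_point z) X = dist (x_axis_point z) Y \<longleftrightarrow> z = axis_center (X, Y)"
proof -
  have "dist (x_axis_point z) X = dist (x_axis_point z) Y
      \<longleftrightarrow> (dist (x_axis_point z) X)\<^sup>2 = (dist (x_axis_point z) Y)\<^sup>2"
    by (simp add: power2_eq_iff_nonneg)
  also have "\<dots> \<longleftrightarrow> 2 * z * (Y $ 1 - X $ 1) = (norm Y)\<^sup>2 - (norm X)\<^sup>2"
    unfolding dist_axis_point_sq by (auto simp: algebra_simps)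
  also have "\<dots> \<longleftrightarrow> z = axis_center (X, Y)"
    using assms by (auto simp: axis_center_def field_simps)
  finally show ?thesis .
qed

lemma mem_voronoi_cell: "x \<in> voronoi_cell P X \<longleftrightarrow> (\<forall>Y\<in>P. dist x X \<le> dist x Y)"
  by (auto simp: voronoi_cell_def le_INF_iff dist_norm)

text \<open>\<open>X\<close> and \<open>Y\<close> are the only points of \<open>P\<close> nearest to
  \<open>c\<close>. By local finiteness all others are farther by a margin \<open>\<delta>\<close>,
  so a move of \<open>c\<close> within the bisecting plane by less than \<open>\<delta> / 2\<close>
  keeps \<open>X\<close> and \<open>Y\<close> nearest. The common face thus contains a relatively
  open piece of that plane, and it lies in the plane.\<close>

lemma creates_facetI:
  assumes P: "\<And>B. bounded B \<Longrightarrow> finite (P \<inter> B)" and XY: "X \<in> P" "Y \<in> P" "X \<noteq> Y"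
    and c: "dist c X = r" "dist c Y = r"
    and others: "\<And>W. W \<in> P \<Longrightarrow> W \<noteq> X \<Longrightarrow> W \<noteq> Y \<Longrightarrow> r < dist c W"
  shows "creates_facet P X Y"
proof -
  define F where "F = P \<inter> cball c (r + 1) - {X, Y}"
  have F: "finite F" unfolding F_def using P[of "cball c (r + 1)"] by auto
  \<comment> \<open>The \<open>1\<close> makes the minimum exist when \<open>F\<close> is empty, and
    it matches the radius \<open>r + 1\<close> of the window: points outside it have the margin
    automatically.\<close>
  define \<delta> where "\<delta> = Min (insert 1 ((\<lambda>W. dist c W - r) ` F))"
  have \<delta>: "\<delta> > 0" "\<delta> \<le> 1" "\<And>W. W \<in> F \<Longrightarrow> \<delta> \<le> dist c W - r"
    using F others by (auto simp: \<delta>_def F_def)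
  have gap: "r + \<delta> \<le> dist c W" if "W \<in> P" "W \<noteq> X" "W \<noteq> Y" for W
    using \<delta>(2) \<delta>(3)[of W] that by (cases "W \<in> F") (auto simp: F_def not_le)
  define H where "H = {x. (Y - X) \<bullet> x = ((norm Y)\<^sup>2 - (norm X)\<^sup>2) / 2}"
  have H: "x \<in> H \<longleftrightarrow> dist x X = dist x Y" for x
  proof -
    have "dist x X = dist x Y \<longleftrightarrow> (dist x X)\<^sup>2 = (dist x Y)\<^sup>2" by (simp add: power2_eq_iff_nonneg)
    also have "\<dots> \<longleftrightarrow> x \<in> H"
      by (auto simp: H_def dist_norm power2_norm_eq_inner inner_diff_left inner_diff_right inner_commute field_simps)
    finally show ?thesis by simp
  qed
  have dimH: "aff_dim H = 2" unfolding H_def using XY(3) by (subst aff_dim_hyperplane) auto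
  have "convex H" unfolding H_def by (rule convex_hyperplane)
  then have "aff_dim (H \<inter> ball c (\<delta> / 2)) = aff_dim H"
    using H[of c] c \<delta>(1)
    by (intro aff_dim_convex_Int_open) auto
  moreover have "H \<inter> ball c (\<delta> / 2) \<subseteq> voronoi_cell P X \<inter> voronoi_cell P Y"
  proof
    fix x assume x: "x \<in> H \<inter> ball c (\<delta> / 2)"
    have e: "dist x X = dist x Y" using x H by auto
    have "dist x X \<le> dist x W" if "W \<in> P" for W
    proof (cases "W = X \<or> W = Y")
      case False
      have "dist x X \<le> \<delta> / 2 + r" using dist_triangle[of x X c] x c by (simp add: dist_commute)
      also have "\<dots> \<le> dist x W"
        using gap[OF that] False dist_triangle[of c W x] x by simp
      finally show ?thesis .
    qed (use e in auto)
    then show "x \<in> voronoi_cell P X \<inter> voronoi_cell P Y" using e by (auto simp: mem_voronoi_cell)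
  qed
  ultimately have "2 \<le> aff_dim (voronoi_cell P X \<inter> voronoi_cell P Y)"
    using aff_dim_subset dimH by metis
  moreover have "voronoi_cell P X \<inter> voronoi_cell P Y \<subseteq> H"
    using XY by (auto simp: H mem_voronoi_cell intro!: antisym)
  then have "aff_dim (voronoi_cell P X \<inter> voronoi_cell P Y) \<le> 2"
    using aff_dim_subset dimH by metis
  ultimately show ?thesis using XY by (simp add: creates_facet_def)
qed

definition empty_ball_pairs :: "(real^3) set \<Rightarrow> ((real^3) \<times> (real^3)) set" where
  "empty_ball_pairs P = {(X, Y). X \<in> P \<and> Y \<in> P \<and> X $ 1 < Y $ 1 \<and>
     P \<inter> ball (x_axis_point (axis_center (X, Y))) (dist (x_axis_point (axis_center (X, Y))) X) = {}}"

text \<open>What almost every configuration satisfies. \<open>inj_x\<close> rules out ties in the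
  order of the nuclei and makes the axis transversal to every bisecting plane;
  \<open>no_triple\<close> rules out a third nucleus on the sphere, where the axis could hit an edge
  or a vertex of the tessellation.\<close>

locale generic_points =
  fixes P :: "(real^3) set"
  assumes fin: "\<And>B. bounded B \<Longrightarrow> finite (P \<inter> B)"
    and inj_x: "\<And>X Y. X \<in> P \<Longrightarrow> Y \<in> P \<Longrightarrow> X $ 1 = Y $ 1 \<Longrightarrow> X = Y"
    and no_triple: "\<And>X Y W. X \<in> P \<Longrightarrow> Y \<in> P \<Longrightarrow> W \<in> P \<Longrightarrow> X $ 1 < Y $ 1 \<Longrightarrow>
      dist (x_axis_point (axis_center (X, Y))) W = dist (x_axis_point (axis_center (X, Y))) X \<Longrightarrow>
      W = X \<or> W = Y"
begin

lemma empty_ball_pairs_nearest: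
  assumes "(X, Y) \<in> empty_ball_pairs P" "z = axis_center (X, Y)"
  shows "dist (x_axis_point z) Y = dist (x_axis_point z) X"
    and "W \<in> P \<Longrightarrow> dist (x_axis_point z) X \<le> dist (x_axis_point z) W"
  using assms equidistant_iff[of X Y z] by (auto simp: empty_ball_pairs_def not_less[symmetric])

text \<open>From right to left the point is the dimension of the common face: with an empty ball,
  \<open>no_triple\<close> makes \<open>X\<close> and \<open>Y\<close> the only nearest points, as
  \<open>creates_facetI\<close> requires.\<close>

lemma facet_pair_iff:
  "creates_facet P X Y \<and> x_axis_point z \<in> voronoi_cell P X \<inter> voronoi_cell P Y \<and> X $ 1 < Y $ 1
    \<longleftrightarrow> (X, Y) \<in> empty_ball_pairs P \<and> z = axis_center (X, Y)"
proof safe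
  assume XY: "creates_facet P X Y" "X $ 1 < Y $ 1"
    and z: "x_axis_point z \<in> voronoi_cell P X" "x_axis_point z \<in> voronoi_cell P Y"
  have P: "X \<in> P" "Y \<in> P" using XY by (auto simp: creates_facet_def)
  have "dist (x_axis_point z) X = dist (x_axis_point z) Y"
    using z P by (auto simp: mem_voronoi_cell intro: antisym)
  then show zz: "z = axis_center (X, Y)" using equidistant_iff[of X Y z] XY(2) by simp
  show "(X, Y) \<in> empty_ball_pairs P"
    using z(1) P XY(2) by (auto simp: empty_ball_pairs_def mem_voronoi_cell not_less zz)
next
  assume S: "(X, Y) \<in> empty_ball_pairs P"
  let ?z = "axis_center (X, Y)"
  have P: "X \<in> P" "Y \<in> P" "X $ 1 < Y $ 1" using S by (auto simp: empty_ball_pairs_def)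
  note n = empty_ball_pairs_nearest[OF S refl]
  show "x_axis_point ?z \<in> voronoi_cell P X" "x_axis_point ?z \<in> voronoi_cell P Y"
    using n by (auto simp: mem_voronoi_cell)
  show "X $ 1 < Y $ 1" by fact
  show "creates_facet P X Y"
  proof (rule creates_facetI[OF fin])
    fix W assume "W \<in> P" "W \<noteq> X" "W \<noteq> Y"
    then show "dist (x_axis_point ?z) X < dist (x_axis_point ?z) W"
      using n(2)[of W] no_triple[OF P(1,2) _ P(3), of W] by force
  qed (use P n in auto)
qed

text \<open>Two pairs with the same centre have the same radius, the distance from the centre to the
  nearest points of \<open>P\<close>. All four points then lie on one sphere,
  \<open>no_triple\<close> leaves only two of them, and the order by first coordinate does the rest.
  For surjectivity the nuclei are swapped if necessary.\<close>

lemma bij_betw_axis_center: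
  "bij_betw axis_center (empty_ball_pairs P) (axis_facet_points P)"
proof -
  have "inj_on axis_center (empty_ball_pairs P)"
  proof (rule inj_onI, clarify)
    fix X Y X' Y'
    assume S: "(X, Y) \<in> empty_ball_pairs P" "(X', Y') \<in> empty_ball_pairs P"
      and eq: "axis_center (X, Y) = axis_center (X', Y')"
    have P: "X \<in> P" "Y \<in> P" "X $ 1 < Y $ 1" "X' \<in> P" "Y' \<in> P" "X' $ 1 < Y' $ 1"
      using S by (auto simp: empty_ball_pairs_def)
    let ?c = "x_axis_point (axis_center (X, Y))"
    note n = empty_ball_pairs_nearest[OF S(1) refl] and n' = empty_ball_pairs_nearest[OF S(2) eq]
    have "dist ?c X' = dist ?c X" using n(2) n'(2) P by (blast intro: antisym)
    moreover have "dist ?c Y' = dist ?c X" using calculation n'(1) by simp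
    ultimately have "X' = X \<or> X' = Y" "Y' = X \<or> Y' = Y" using no_triple P by blast+
    then show "X = X' \<and> Y = Y'" using P by auto
  qed
  moreover have "axis_center ` empty_ball_pairs P = axis_facet_points P"
  proof (intro set_eqI iffI)
    fix z assume "z \<in> axis_center ` empty_ball_pairs P"
    then obtain X Y where "(X, Y) \<in> empty_ball_pairs P" "z = axis_center (X, Y)" by auto
    then show "z \<in> axis_facet_points P"
      using facet_pair_iff[of X Y z] unfolding axis_facet_points_def by blast
  next
    fix z assume "z \<in> axis_facet_points P"
    then obtain X Y where XY: "creates_facet P X Y" "x_axis_point z \<in> voronoi_cell P X \<inter> voronoi_cell P Y"
      by (auto simp: axis_facet_points_def)
    have "X $ 1 \<noteq> Y $ 1" using XY(1) inj_x by (auto simp: creates_facet_def)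
    moreover have "creates_facet P Y X" using XY(1) by (auto simp: creates_facet_def Int_commute)
    ultimately show "z \<in> axis_center ` empty_ball_pairs P"
      using XY facet_pair_iff[of X Y z] facet_pair_iff[of Y X z]
      by (cases "X $ 1 < Y $ 1") (auto simp: image_iff)
  qed
  ultimately show ?thesis by (simp add: bij_betw_def)
qed

text \<open>Injectivity of \<open>axis_center\<close> leaves one pair per centre, so the definite
  description is determined.\<close>

lemma facet_nuclei_axis_center:
  assumes "p \<in> empty_ball_pairs P"
  shows "facet_nuclei P (axis_center p) = p"
proof -
  have "facet_nuclei P (axis_center p) = (THE q. q \<in> empty_ball_pairs P \<and> axis_center p = axis_center q)"
    unfolding facet_nuclei_def facet_pair_iff by (simp add: case_prod_unfold)
  also have "\<dots> = p"
    using assms bij_betw_imp_inj_on[OF bij_betw_axis_center] by (intro the_equality) (auto dest: inj_onD)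
  finally show ?thesis .
qed

text \<open>Reindexing by the bijection turns the sum over axis points into a number of pairs, the
  form the moment formulas handle. For an infinite set both sides are infinite.\<close>

lemma infsum_marks:
  "(\<Sum>\<^sub>\<infinity>z\<in>axis_facet_points P. indicator {0..1} z * indicator B (facet_angle u P z) :: ennreal)
    = cnt {p \<in> empty_ball_pairs P. axis_center p \<in> {0..1} \<and>
        oriented_angle u (x_axis_point (axis_center p)) (fst p) (snd p) \<in> B}"
    (is "_ = cnt ?S")
proof -
  have "(\<Sum>\<^sub>\<infinity>z\<in>axis_facet_points P. indicator {0..1} z * indicator B (facet_angle u P z) :: ennreal)
      = (\<Sum>\<^sub>\<infinity>p\<in>empty_ball_pairs P. indicator {0..1} (axis_center p) * indicator B (facet_angle u P (axis_center p)))"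
    by (rule infsum_reindex_bij_betw[OF bij_betw_axis_center, symmetric])
  also have "\<dots> = (\<Sum>\<^sub>\<infinity>p\<in>?S. 1)"
    by (intro infsum_cong_neutral)
       (auto simp: facet_angle_def facet_nuclei_axis_center indicator_def case_prod_unfold)
  also have "\<dots> = cnt ?S"
  proof (cases "finite ?S")
    case False
    then have "(\<Sum>\<^sub>\<infinity>p\<in>?S. (1 :: ennreal)) = \<infinity>"
      by (intro infsum_superconst_infinite_ennreal[where b = 1]) auto
    then show ?thesis using False by simp
  qed (simp add: emeasure_count_space_finite)
  finally show ?thesis .
qed

end

subsection \<open>Integration in radial coordinates\<close>

lemma borel_measurable_fst_snd [measurable (raw)]:
  fixes f :: "'a \<Rightarrow> 'b::second_countable_topology \<times> 'c::second_countable_topology"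
  assumes "f \<in> borel_measurable M"
  shows "(\<lambda>x. fst (f x)) \<in> borel_measurable M" "(\<lambda>x. snd (f x)) \<in> borel_measurable M"
  using assms by (auto intro!: measurable_compose[OF assms] borel_measurable_continuous_onI continuous_intros)

lemma borel_Times_sets:
  fixes A :: "'a::second_countable_topology set" and B :: "'b::second_countable_topology set"
  shows "A \<in> sets borel \<Longrightarrow> B \<in> sets borel \<Longrightarrow> A \<times> B \<in> sets borel"
  by (simp flip: borel_prod)

lemma borel_measurable_arccos [measurable]: "arccos \<in> borel_measurable borel"
proof -
  \<comment> \<open>Outside [-1, 1] the description defining \<open>arccos\<close> cannot be
    satisfied, so every such argument gives the same unspecified value.\<close>
  have "arccos = (\<lambda>y. if y \<in> {-1..1} then arccos y else (THE x. False))"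
  proof
    fix y :: real
    have "(\<lambda>x. 0 \<le> x \<and> x \<le> pi \<and> cos x = y) = (\<lambda>x. False)" if "y \<notin> {-1..1}"
      using that cos_le_one cos_ge_minus_one by (auto simp: fun_eq_iff)
    then show "arccos y = (if y \<in> {-1..1} then arccos y else (THE x. False))"
      unfolding arccos_def by auto
  qed
  moreover have "\<dots> \<in> borel_measurable borel"
    by (intro borel_measurable_continuous_on_if continuous_on_arccos') auto
  ultimately show ?thesis by simp
qed

lemma nn_integral_lborel_pair:
  assumes [measurable]: "f \<in> borel_measurable borel"
  shows "(\<integral>\<^sup>+q. f q \<partial>(lborel :: ('a::euclidean_space \<times> 'b::euclidean_space) measure)) = (\<integral>\<^sup>+x. \<integral>\<^sup>+y. f (x, y) \<partial>lborel \<partial>lborel)"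
    and "(\<integral>\<^sup>+q. f q \<partial>(lborel :: ('a::euclidean_space \<times> 'b::euclidean_space) measure)) = (\<integral>\<^sup>+y. \<integral>\<^sup>+x. f (x, y) \<partial>lborel \<partial>lborel)"
proof -
  have [measurable]: "f \<in> borel_measurable (lborel \<Otimes>\<^sub>M lborel)"
    using assms by (simp add: lborel_prod)
  show "(\<integral>\<^sup>+q. f q \<partial>(lborel :: ('a \<times> 'b) measure)) = (\<integral>\<^sup>+x. \<integral>\<^sup>+y. f (x, y) \<partial>lborel \<partial>lborel)"
    by (subst lborel_prod[symmetric], subst lborel.nn_integral_fst[symmetric]) auto
  then show "(\<integral>\<^sup>+q. f q \<partial>(lborel :: ('a \<times> 'b) measure)) = (\<integral>\<^sup>+y. \<integral>\<^sup>+x. f (x, y) \<partial>lborel \<partial>lborel)"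
    by (subst lborel_pair.Fubini') (auto simp: borel_prod)
qed

lemma vector3_eq_axis: "(vector [a, b, c] :: real^3) = a *\<^sub>R axis 1 1 + b *\<^sub>R axis 2 1 + c *\<^sub>R axis 3 1"
  by (simp add: vec_eq_iff forall_3 axis_def)

lemma measurable_vector3 [measurable (raw)]:
  assumes "f \<in> borel_measurable M" "g \<in> borel_measurable M" "h \<in> borel_measurable M"
  shows "(\<lambda>x. vector [f x, g x, h x] :: real^3) \<in> borel_measurable M"
  unfolding vector3_eq_axis using assms by measurable

lemma lborel_real3:
  "lborel = distr lborel borel (\<lambda>(a, q). vector [a, fst q, snd q] :: real^3)"
proof (rule lborel_eqI)
  fix l u :: "real^3"
  assume "\<And>b. b \<in> Basis \<Longrightarrow> l \<bullet> b \<le> u \<bullet> b"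
  then have le: "l $ i \<le> u $ i" for i using cart_eq_inner_axis axis_in_Basis_iff by (metis Basis_real_def insertI1)
  have B: "(Basis :: (real^3) set) = {axis 1 1, axis 2 1, axis 3 1}"
    by (auto simp: Basis_vec_def UNIV_3)
  have "(\<lambda>(a, q). vector [a, fst q, snd q] :: real^3) -` box l u
      = {l $ 1 <..< u $ 1} \<times> ({l $ 2 <..< u $ 2} \<times> {l $ 3 <..< u $ 3})"
    by (auto simp: mem_box_cart forall_3)
  moreover have "(\<lambda>(a, q). vector [a, fst q, snd q] :: real^3) \<in> borel_measurable borel"
    unfolding case_prod_unfold by measurable
  ultimately have "emeasure (distr lborel borel (\<lambda>(a, q). vector [a, fst q, snd q] :: real^3)) (box l u)
      = ennreal (u $ 1 - l $ 1) * (ennreal (u $ 2 - l $ 2) * ennreal (u $ 3 - l $ 3))"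
    using le by (subst emeasure_distr) (auto simp: emeasure_lborel_Times borel_Times_sets)
  also have "\<dots> = ennreal (\<Prod>b\<in>Basis. (u - l) \<bullet> b)"
    using le unfolding B by (simp add: axis_eq_axis inner_axis ennreal_mult)
  finally show "emeasure (distr lborel borel (\<lambda>(a, q). vector [a, fst q, snd q] :: real^3)) (box l u)
     = ennreal (\<Prod>b\<in>Basis. (u - l) \<bullet> b)" .
qed simp

lemma nn_integral_real3:
  fixes f :: "real^3 \<Rightarrow> ennreal"
  assumes [measurable]: "f \<in> borel_measurable borel"
  shows "(\<integral>\<^sup>+x. f x \<partial>lborel) = (\<integral>\<^sup>+q. \<integral>\<^sup>+a. f (vector [a, fst q, snd q]) \<partial>lborel \<partial>lborel)"
    and "(\<integral>\<^sup>+x. f x \<partial>lborel) = (\<integral>\<^sup>+a. \<integral>\<^sup>+q. f (vector [a, fst q, snd q]) \<partial>lborel \<partial>lborel)"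
proof -
  have [measurable]: "(\<lambda>(a, q). vector [a, fst q, snd q] :: real^3) \<in> borel_measurable borel"
    unfolding case_prod_unfold by measurable
  have *: "(\<integral>\<^sup>+x. f x \<partial>lborel) = (\<integral>\<^sup>+p. f (case p of (a, q) \<Rightarrow> vector [a, fst q, snd q]) \<partial>lborel)"
    by (subst lborel_real3, subst nn_integral_distr) auto
  show "(\<integral>\<^sup>+x. f x \<partial>lborel) = (\<integral>\<^sup>+q. \<integral>\<^sup>+a. f (vector [a, fst q, snd q]) \<partial>lborel \<partial>lborel)"
    unfolding * by (subst nn_integral_lborel_pair(2)) auto
  show "(\<integral>\<^sup>+x. f x \<partial>lborel) = (\<integral>\<^sup>+a. \<integral>\<^sup>+q. f (vector [a, fst q, snd q]) \<partial>lborel \<partial>lborel)"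
    unfolding * by (subst nn_integral_lborel_pair(1)) auto
qed

text \<open>The disc of squared radius \<open>a\<close> has area pi a, which is linear in
  \<open>a\<close>; so the squared radius has constant density pi.\<close>

lemma distr_sum_squares:
  "distr (lborel :: (real \<times> real) measure) borel (\<lambda>q. (fst q)\<^sup>2 + (snd q)\<^sup>2)
    = density lborel (\<lambda>s. ennreal pi * indicator {0..} s)"
proof (rule measure_eqI_generator_eq[where E = "range atMost" and \<Omega> = UNIV and A = "\<lambda>n. {..real n}"])
  show "Int_stable (range (atMost :: real \<Rightarrow> real set))"
    by (auto simp: Int_stable_def)
  have *: "emeasure (distr (lborel :: (real \<times> real) measure) borel (\<lambda>q. (fst q)\<^sup>2 + (snd q)\<^sup>2)) {..a} = ennreal (pi * max 0 a)"
    for a :: real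
  proof (cases "a \<ge> 0")
    case True
    have "(\<lambda>q. (fst q)\<^sup>2 + (snd q)\<^sup>2) -` {..a} = cball (0 :: real \<times> real) (sqrt a)"
      using True by (auto simp: norm_Pair)
    then show ?thesis
      using True by (subst emeasure_distr) (auto simp: emeasure_cball unit_ball_vol_numeral fact_numeral)
  next
    case False
    have "(\<lambda>q. (fst q)\<^sup>2 + (snd q)\<^sup>2) -` {..a} = ({} :: (real \<times> real) set)"
      using False by (auto dest: order_trans[OF sum_power2_ge_zero])
    then show ?thesis using False by (subst emeasure_distr) auto
  qed
  show "emeasure (distr (lborel :: (real \<times> real) measure) borel (\<lambda>q. (fst q)\<^sup>2 + (snd q)\<^sup>2)) X
     = emeasure (density lborel (\<lambda>s. ennreal pi * indicator {0..} s)) X" if "X \<in> range atMost" for X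
  proof -
    from that obtain a where X: "X = {..a}" by auto
    have "emeasure (density lborel (\<lambda>s. ennreal pi * indicator {0..} s)) X = (\<integral>\<^sup>+s. ennreal pi * indicator {0..a} s \<partial>lborel)"
      unfolding X by (subst emeasure_density) (auto intro!: nn_integral_cong simp: indicator_def)
    also have "\<dots> = ennreal (pi * max 0 a)"
      by (subst nn_integral_cmult_indicator) (auto simp: max_def ennreal_mult)
    finally show ?thesis unfolding X * by simp
  qed
  show "emeasure (distr (lborel :: (real \<times> real) measure) borel (\<lambda>q. (fst q)\<^sup>2 + (snd q)\<^sup>2)) {..real n} \<noteq> \<infinity>" for n
    unfolding * by simp
  show "(\<Union>n. {..real n}) = UNIV" using real_arch_simple by blast
qed (auto simp: borel_eq_atMost)

lemma nn_integral_sum_squares: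
  fixes F :: "real \<Rightarrow> ennreal"
  assumes [measurable]: "F \<in> borel_measurable borel"
  shows "(\<integral>\<^sup>+q. F ((fst q)\<^sup>2 + (snd q)\<^sup>2) \<partial>(lborel :: (real \<times> real) measure))
    = ennreal pi * (\<integral>\<^sup>+s. F s * indicator {0..} s \<partial>lborel)"
proof -
  have "(\<integral>\<^sup>+q. F ((fst q)\<^sup>2 + (snd q)\<^sup>2) \<partial>(lborel :: (real \<times> real) measure))
      = (\<integral>\<^sup>+s. F s \<partial>distr (lborel :: (real \<times> real) measure) borel (\<lambda>q. (fst q)\<^sup>2 + (snd q)\<^sup>2))"
    by (subst nn_integral_distr) auto
  then show ?thesis
    unfolding distr_sum_squares
    by (simp add: nn_integral_density mult.assoc mult.commute[of "indicator _ _"] nn_integral_cmult)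
qed

text \<open>Completing the square in the first variable and rescaling both variables gives a sum of
  two squares. The Jacobians 1 / sqrt A and sqrt (A / \<open>\<Delta>\<close>) multiply to the
  inverse root of the determinant.\<close>

lemma nn_integral_quadratic_form:
  fixes F :: "real \<Rightarrow> ennreal"
  assumes [measurable]: "F \<in> borel_measurable borel" and A: "A > 0" and \<Delta>: "A * C - B\<^sup>2 > 0"
  shows "(\<integral>\<^sup>+q. F (A * (fst q)\<^sup>2 + 2 * B * fst q * snd q + C * (snd q)\<^sup>2) \<partial>(lborel :: (real \<times> real) measure))
    = ennreal (pi / sqrt (A * C - B\<^sup>2)) * (\<integral>\<^sup>+s. F s * indicator {0..} s \<partial>lborel)"
proof -
  define \<Delta> where "\<Delta> = A * C - B\<^sup>2"
  have D: "\<Delta> > 0" using \<Delta> by (simp add: \<Delta>_def)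
  have inner: "(\<integral>\<^sup>+y. F (A * y\<^sup>2 + 2 * B * y * z + C * z\<^sup>2) \<partial>lborel)
      = ennreal (1 / sqrt A) * (\<integral>\<^sup>+y. F (y\<^sup>2 + \<Delta> / A * z\<^sup>2) \<partial>lborel)" for z
  proof -
    have "A * (- (B * z / A) + 1 / sqrt A * y)\<^sup>2 + 2 * B * (- (B * z / A) + 1 / sqrt A * y) * z + C * z\<^sup>2
        = y\<^sup>2 + \<Delta> / A * z\<^sup>2" for y
    proof -
      define a where "a = sqrt A"
      have a: "a > 0" "A = a * a" using A by (auto simp: a_def)
      show ?thesis
        unfolding a_def[symmetric] using a(1)
        by (simp add: a(2) \<Delta>_def power2_eq_square field_simps)
    qed
    then show ?thesis
      using A by (subst nn_integral_real_affine[where c = "1 / sqrt A" and t = "- (B * z / A)"]) auto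
  qed
  have "(\<integral>\<^sup>+q. F (A * (fst q)\<^sup>2 + 2 * B * fst q * snd q + C * (snd q)\<^sup>2) \<partial>(lborel :: (real \<times> real) measure))
     = ennreal (1 / sqrt A) * (\<integral>\<^sup>+z. \<integral>\<^sup>+y. F (y\<^sup>2 + \<Delta> / A * z\<^sup>2) \<partial>lborel \<partial>lborel)"
    by (subst nn_integral_lborel_pair(2)) (auto simp: inner nn_integral_cmult)
  also have "(\<integral>\<^sup>+z. \<integral>\<^sup>+y. F (y\<^sup>2 + \<Delta> / A * z\<^sup>2) \<partial>lborel \<partial>lborel)
     = ennreal (sqrt (A / \<Delta>)) * (\<integral>\<^sup>+z. \<integral>\<^sup>+y. F (y\<^sup>2 + z\<^sup>2) \<partial>lborel \<partial>lborel)"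
  proof -
    have "\<Delta> / A * (0 + sqrt (A / \<Delta>) * z)\<^sup>2 = z\<^sup>2" for z
      using A D by (simp add: power_mult_distrib)
    then show ?thesis
      using A D by (subst nn_integral_real_affine[where c = "sqrt (A / \<Delta>)" and t = 0]) auto
  qed
  also have "(\<integral>\<^sup>+z. \<integral>\<^sup>+y. F (y\<^sup>2 + z\<^sup>2) \<partial>lborel \<partial>lborel) = ennreal pi * (\<integral>\<^sup>+s. F s * indicator {0..} s \<partial>lborel)"
    by (subst nn_integral_sum_squares[symmetric], simp, subst nn_integral_lborel_pair(2)) auto
  also have "ennreal (1 / sqrt A) * (ennreal (sqrt (A / \<Delta>)) * (ennreal pi * (\<integral>\<^sup>+s. F s * indicator {0..} s \<partial>lborel)))
      = ennreal (1 / sqrt A * sqrt (A / \<Delta>) * pi) * (\<integral>\<^sup>+s. F s * indicator {0..} s \<partial>lborel)"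
  proof -
    have "ennreal (x * y * z) = ennreal x * (ennreal y * ennreal z)" if "x \<ge> 0" "y \<ge> 0" "z \<ge> 0" for x y z
      using that by (simp add: ennreal_mult mult.assoc)
    from this[of "1 / sqrt A" "sqrt (A / \<Delta>)" pi] show ?thesis using A D by (simp add: mult.assoc)
  qed
  also have "1 / sqrt A * sqrt (A / \<Delta>) * pi = pi / sqrt \<Delta>"
    using A D by (simp add: real_sqrt_divide)
  finally show ?thesis by (simp add: \<Delta>_def)
qed

text \<open>Substitution on compact intervals, followed by monotone limits on both sides. The end
  points \<open>Suc n\<close> keep the intervals nondegenerate.\<close>

lemma nn_integral_substitution_halfline:
  fixes f :: "real \<Rightarrow> ennreal" and g g' :: "real \<Rightarrow> real"
  assumes [measurable]: "f \<in> borel_measurable borel" "g \<in> borel_measurable borel" "g' \<in> borel_measurable borel"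
    and deriv: "\<And>x. x \<ge> 0 \<Longrightarrow> (g has_real_derivative g' x) (at x)"
    and cont: "continuous_on {0..} g'" and nonneg: "\<And>x. x \<ge> 0 \<Longrightarrow> g' x \<ge> 0"
    and g: "g 0 = 0" "filterlim g at_top at_top"
  shows "(\<integral>\<^sup>+x. f x * indicator {0..} x \<partial>lborel) = (\<integral>\<^sup>+x. f (g x) * ennreal (g' x) * indicator {0..} x \<partial>lborel)"
proof -
  have mono: "g x \<le> g y" if "0 \<le> x" "x \<le> y" for x y
    using that(2)
  proof (rule DERIV_nonneg_imp_nondecreasing)
    fix w assume "x \<le> w" "w \<le> y"
    then show "\<exists>z. (g has_real_derivative z) (at w) \<and> 0 \<le> z"
      using that deriv nonneg by (intro exI[of _ "g' w"]) auto
  qed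
  have S: "(\<integral>\<^sup>+x. h x * indicator {0..} x \<partial>lborel) = (SUP n. \<integral>\<^sup>+x. h x * indicator (A n) x \<partial>lborel)"
    if [measurable]: "h \<in> borel_measurable borel" "\<And>n. A n \<in> sets borel"
      and A: "incseq A" "(\<Union>n. A n) = {0..}" for h :: "real \<Rightarrow> ennreal" and A :: "nat \<Rightarrow> real set"
    unfolding A(2)[symmetric] SUP_mult_indicator[symmetric] using A(1)
    by (intro nn_integral_monotone_convergence_SUP)
       (auto simp: incseq_def le_fun_def intro!: mult_left_mono split: split_indicator)
  have cover: "(\<Union>n. {0..g (real (Suc n))}) = {0..}"
  proof (intro set_eqI iffI)
    fix x :: real assume x: "x \<in> {0..}"
    have "eventually (\<lambda>y. g y \<ge> x) at_top" using g(2) by (auto simp: filterlim_at_top)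
    then have "eventually (\<lambda>n. g (real n) \<ge> x) sequentially"
      by (rule eventually_compose_filterlim) (rule filterlim_real_sequentially)
    then obtain n where "g (real n) \<ge> x" by (auto simp: eventually_sequentially)
    moreover have "g (real n) \<le> g (real (Suc n))" by (intro mono) auto
    ultimately show "x \<in> (\<Union>n. {0..g (real (Suc n))})" using x by (auto intro: order_trans)
  qed auto
  have "(\<integral>\<^sup>+x. f x * indicator {0..} x \<partial>lborel) = (SUP n. \<integral>\<^sup>+x. f x * indicator {0..g (real (Suc n))} x \<partial>lborel)"
    using mono by (intro S cover) (auto simp: incseq_def intro: order_trans)
  also have "\<dots> = (SUP n. \<integral>\<^sup>+x. f (g x) * ennreal (g' x) * indicator {0..real (Suc n)} x \<partial>lborel)"
  proof (intro SUP_cong refl)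
    fix n
    show "(\<integral>\<^sup>+x. f x * indicator {0..g (real (Suc n))} x \<partial>lborel)
      = (\<integral>\<^sup>+x. f (g x) * ennreal (g' x) * indicator {0..real (Suc n)} x \<partial>lborel)"
      using nn_integral_substitution_aux[of f 0 "real (Suc n)" g g']
        deriv nonneg continuous_on_subset[OF cont, of "{0..real (Suc n)}"] g(1) by auto
  qed
  also have "\<dots> = (\<integral>\<^sup>+x. f (g x) * ennreal (g' x) * indicator {0..} x \<partial>lborel)"
  proof (rule S[symmetric])
    show "(\<Union>n. {0..real (Suc n)}) = {0..}"
    proof (intro set_eqI iffI)
      fix x :: real assume x: "x \<in> {0..}"
      obtain n where "x \<le> real n" using real_arch_simple by blast
      then show "x \<in> (\<Union>n. {0..real (Suc n)})" using x by (auto intro!: exI[of _ n])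
    qed auto
  qed (auto simp: incseq_def)
  finally show ?thesis .
qed

text \<open>Both sides are multiples of the integral of y^4 exp (- c y^3) over the half-line: the
  left one by p = y^2, and Gamma (5/3) by x = c y^3 in Euler's integral.\<close>

lemma nn_integral_radial:
  assumes c: "c > 0"
  shows "(\<integral>\<^sup>+p. ennreal (exp (- (c * sqrt p ^ 3)) * (p * sqrt p)) * indicator {0..} p \<partial>lborel)
    = ennreal (2 / 3 * c powr (- 5 / 3) * Gamma (5 / 3))"
proof -
  have 1: "(\<integral>\<^sup>+p. ennreal (exp (- (c * sqrt p ^ 3)) * (p * sqrt p)) * indicator {0..} p \<partial>lborel)
     = (\<integral>\<^sup>+y. ennreal (2 * exp (- (c * y ^ 3)) * y ^ 4) * indicator {0..} y \<partial>lborel)"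
  proof (subst nn_integral_substitution_halfline[where g = "\<lambda>y. y\<^sup>2" and g' = "\<lambda>y. 2 * y"])
    show "filterlim (\<lambda>y::real. y\<^sup>2) at_top at_top" by real_asymp
    show "(\<integral>\<^sup>+y. ennreal (exp (- (c * sqrt (y\<^sup>2) ^ 3)) * (y\<^sup>2 * sqrt (y\<^sup>2))) * ennreal (2 * y) * indicator {0..} y \<partial>lborel)
      = (\<integral>\<^sup>+y. ennreal (2 * exp (- (c * y ^ 3)) * y ^ 4) * indicator {0..} y \<partial>lborel)"
      by (intro nn_integral_cong)
         (auto simp: indicator_def power2_eq_square power4_eq_xxxx mult_ac simp flip: ennreal_mult'')
  qed (auto intro!: derivative_eq_intros continuous_intros)
  have "ennreal (Gamma (5 / 3)) = (\<integral>\<^sup>+x. ennreal (x powr (2 / 3) * exp (- x)) * indicator {0..} x \<partial>lborel)"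
  proof -
    have "ennreal (Gamma (5 / 3)) = (\<integral>\<^sup>+x. ennreal (indicator {0..} x * x powr (5 / 3 - 1) / exp x) \<partial>lborel)"
      by (rule Gamma_conv_nn_integral_real) simp
    also have "\<dots> = (\<integral>\<^sup>+x. ennreal (x powr (2 / 3) * exp (- x)) * indicator {0..} x \<partial>lborel)"
      by (intro nn_integral_cong) (auto simp: indicator_def exp_minus field_simps)
    finally show ?thesis .
  qed
  also have "\<dots> = (\<integral>\<^sup>+y. ennreal ((c * y ^ 3) powr (2 / 3) * exp (- (c * y ^ 3))) * ennreal (3 * c * y\<^sup>2) * indicator {0..} y \<partial>lborel)"
  proof (rule nn_integral_substitution_halfline)
    show "filterlim (\<lambda>y::real. c * y ^ 3) at_top at_top" using c by real_asymp
  qed (use c in \<open>auto intro!: derivative_eq_intros continuous_intros\<close>)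
  also have "\<dots> = (\<integral>\<^sup>+y. ennreal (3 / 2 * c powr (5 / 3)) * (ennreal (2 * exp (- (c * y ^ 3)) * y ^ 4) * indicator {0..} y) \<partial>lborel)"
  proof (intro nn_integral_cong)
    fix y :: real
    have "(c * y ^ 3) powr (2 / 3) * exp (- (c * y ^ 3)) * (3 * c * y\<^sup>2)
        = 3 / 2 * c powr (5 / 3) * (2 * exp (- (c * y ^ 3)) * y ^ 4)" if y: "y \<ge> 0"
    proof -
      have "(c * y ^ 3) powr (2 / 3) = c powr (2 / 3) * y\<^sup>2"
      proof (cases "y = 0")
        case False
        then have "(y ^ 3) powr (2 / 3) = y powr (3 * (2 / 3))" using y
          by (subst powr_powr[symmetric]) (simp add: powr_numeral)
        also have "\<dots> = y\<^sup>2" using y False by (simp add: powr_numeral)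
        finally show ?thesis using c y by (simp add: powr_mult)
      qed simp
      moreover have "c powr (5 / 3) = c powr (2 / 3) * c"
        using c powr_add[of c "2 / 3" 1] by simp
      ultimately show ?thesis by (simp add: power2_eq_square power4_eq_xxxx mult_ac)
    qed
    then show "ennreal ((c * y ^ 3) powr (2 / 3) * exp (- (c * y ^ 3))) * ennreal (3 * c * y\<^sup>2) * indicator {0..} y
      = ennreal (3 / 2 * c powr (5 / 3)) * (ennreal (2 * exp (- (c * y ^ 3)) * y ^ 4) * indicator {0..} y)"
      using c by (auto simp: indicator_def simp flip: ennreal_mult')
  qed
  also have "\<dots> = ennreal (3 / 2 * c powr (5 / 3)) * (\<integral>\<^sup>+y. ennreal (2 * exp (- (c * y ^ 3)) * y ^ 4) * indicator {0..} y \<partial>lborel)"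
    by (intro nn_integral_cmult) measurable
  finally have G: "ennreal (Gamma (5 / 3)) = ennreal (3 / 2 * c powr (5 / 3)) * (\<integral>\<^sup>+y. ennreal (2 * exp (- (c * y ^ 3)) * y ^ 4) * indicator {0..} y \<partial>lborel)" .
  have "ennreal (2 / 3 * c powr (- 5 / 3) * Gamma (5 / 3)) = ennreal (2 / 3 * c powr (- 5 / 3)) * ennreal (Gamma (5 / 3))"
    by (intro ennreal_mult) auto
  also have "\<dots> = ennreal (2 / 3 * c powr (- 5 / 3) * (3 / 2 * c powr (5 / 3))) *
      (\<integral>\<^sup>+y. ennreal (2 * exp (- (c * y ^ 3)) * y ^ 4) * indicator {0..} y \<partial>lborel)"
    unfolding G by (subst ennreal_mult) (auto simp: mult.assoc)
  also have "2 / 3 * c powr (- 5 / 3) * (3 / 2 * c powr (5 / 3)) = 1"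
    using c by (simp add: powr_minus field_simps)
  finally show ?thesis using 1 by simp
qed

text \<open>Substitution \<open>\<tau> = sin\<^sup>2 (t / 2)\<close>.\<close>

lemma nn_integral_angle:
  assumes [measurable]: "B \<in> sets borel" and B: "B \<subseteq> {0<..<2 * pi}"
  shows "(\<integral>\<^sup>+\<tau>. ennreal (sqrt \<tau>) * (indicator B (arccos (1 - 2 * \<tau>)) + indicator B (2 * pi - arccos (1 - 2 * \<tau>)))
      * indicator {0..1} \<tau> \<partial>lborel)
    = (\<integral>\<^sup>+t\<in>B. ennreal (\<bar>cos (t / 2)\<bar> * (sin (t / 2))\<^sup>2) \<partial>lborel)"
proof -
  let ?k = "\<lambda>t. ennreal (\<bar>cos (t / 2)\<bar> * (sin (t / 2))\<^sup>2)"
  define f where "f \<tau> = ennreal (sqrt \<tau>) * (indicator B (arccos (1 - 2 * \<tau>)) + indicator B (2 * pi - arccos (1 - 2 * \<tau>)))" for \<tau>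
  have [measurable]: "f \<in> borel_measurable borel" unfolding f_def by measurable
  have "(\<integral>\<^sup>+\<tau>. f \<tau> * indicator {0..1} \<tau> \<partial>lborel)
      = (\<integral>\<^sup>+t. f ((sin (t / 2))\<^sup>2) * ennreal (sin (t / 2) * cos (t / 2)) * indicator {0..pi} t \<partial>lborel)"
  proof -
    have "((\<lambda>t. (sin (t / 2))\<^sup>2) has_real_derivative sin (x / 2) * cos (x / 2)) (at x)" for x
      by (auto intro!: derivative_eq_intros)
    moreover have "continuous_on {0..pi} (\<lambda>t. sin (t / 2) * cos (t / 2))"
      by (intro continuous_intros) auto
    moreover have "0 \<le> sin (x / 2) * cos (x / 2)" if "x \<in> {0..pi}" for x
      using that by (auto intro!: mult_nonneg_nonneg sin_ge_zero cos_ge_zero)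
    ultimately show ?thesis
      using nn_integral_substitution_aux[of f 0 pi "\<lambda>t. (sin (t / 2))\<^sup>2" "\<lambda>t. sin (t / 2) * cos (t / 2)"]
      by simp
  qed
  also have "\<dots> = (\<integral>\<^sup>+t. ?k t * indicator B t * indicator {0..pi} t + ?k t * indicator B (2 * pi - t) * indicator {0..pi} t \<partial>lborel)"
  proof (intro nn_integral_cong)
    fix t :: real
    show "f ((sin (t / 2))\<^sup>2) * ennreal (sin (t / 2) * cos (t / 2)) * indicator {0..pi} t
       = ?k t * indicator B t * indicator {0..pi} t + ?k t * indicator B (2 * pi - t) * indicator {0..pi} t"
    proof (cases "t \<in> {0..pi}")
      case True
      have s: "sin (t / 2) \<ge> 0" "cos (t / 2) \<ge> 0" using True by (auto intro!: sin_ge_zero cos_ge_zero)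
      have "1 - 2 * (sin (t / 2))\<^sup>2 = cos t" using cos_double_sin[of "t / 2"] by simp
      then have "arccos (1 - 2 * (sin (t / 2))\<^sup>2) = t" using True by (simp add: arccos_cos)
      then have "f ((sin (t / 2))\<^sup>2) * ennreal (sin (t / 2) * cos (t / 2))
         = (ennreal (sin (t / 2)) * ennreal (sin (t / 2) * cos (t / 2))) * (indicator B t + indicator B (2 * pi - t))"
        using s by (simp add: f_def mult_ac)
      also have "ennreal (sin (t / 2)) * ennreal (sin (t / 2) * cos (t / 2)) = ?k t"
        using s by (simp add: power2_eq_square mult_ac flip: ennreal_mult)
      finally show ?thesis using True by (simp add: distrib_left)
    qed simp
  qed
  also have "\<dots> = (\<integral>\<^sup>+t. ?k t * indicator B t * indicator {0..pi} t \<partial>lborel)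
      + (\<integral>\<^sup>+t. ?k t * indicator B (2 * pi - t) * indicator {0..pi} t \<partial>lborel)"
    by (intro nn_integral_add) measurable
  \<comment> \<open>The reflection of t about pi carries [0, pi] to [pi, 2 pi]; it changes the sign
    of cos (t/2), which the absolute value absorbs.\<close>
  also have "(\<integral>\<^sup>+t. ?k t * indicator B (2 * pi - t) * indicator {0..pi} t \<partial>lborel)
      = (\<integral>\<^sup>+t. ?k t * indicator B t * indicator {pi..2 * pi} t \<partial>lborel)"
  proof -
    have "?k (2 * pi + - 1 * t) = ?k t" for t
      by (simp add: cos_diff sin_diff diff_divide_distrib)
    then show ?thesis
      by (subst nn_integral_real_affine[where c = "- 1" and t = "2 * pi"])
         (auto intro!: nn_integral_cong split: split_indicator)
  qed
  also have "(\<integral>\<^sup>+t. ?k t * indicator B t * indicator {0..pi} t \<partial>lborel) + \<dots>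
      = (\<integral>\<^sup>+t. ?k t * indicator B t * indicator {0..pi} t + ?k t * indicator B t * indicator {pi..2 * pi} t \<partial>lborel)"
    by (intro nn_integral_add[symmetric]) measurable
  \<comment> \<open>The two intervals share only the point pi, where the kernel vanishes, so the
    integrands agree everywhere.\<close>
  also have "\<dots> = (\<integral>\<^sup>+t. ?k t * indicator B t \<partial>lborel)"
    using B by (intro nn_integral_cong) (fastforce simp: indicator_def)
  finally show ?thesis by (simp add: f_def)
qed

section \<open>Difference and midpoint coordinates for pairs of points, and the bisecting
  plane\<close>

lemma measurable_vec_nth [measurable (raw)]:
  fixes f :: "'a \<Rightarrow> real^'n"
  assumes "f \<in> borel_measurable M"
  shows "(\<lambda>x. f x $ i) \<in> borel_measurable M"
  by (intro measurable_compose[OF assms] borel_measurable_continuous_onI continuous_intros)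

lemma measurable_cross3 [measurable (raw)]:
  assumes [measurable]: "f \<in> borel_measurable M" "g \<in> borel_measurable M"
  shows "(\<lambda>x. cross3 (f x) (g x)) \<in> borel_measurable M"
  unfolding cross3_def by measurable

lemma nn_integral_lborel_translate:
  fixes f :: "'a::euclidean_space \<Rightarrow> ennreal"
  assumes [measurable]: "f \<in> borel_measurable borel"
  shows "(\<integral>\<^sup>+x. f x \<partial>lborel) = (\<integral>\<^sup>+x. f (c + x) \<partial>lborel)"
  by (subst lborel_distr_plus[of c, symmetric], subst nn_integral_distr) auto

lemma nn_integral_lborel_uminus:
  fixes f :: "'a::euclidean_space \<Rightarrow> ennreal"
  assumes [measurable]: "f \<in> borel_measurable borel"
  shows "(\<integral>\<^sup>+x. f x \<partial>lborel) = (\<integral>\<^sup>+x. f (- x) \<partial>lborel)"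
  by (subst lborel_affine[of "- 1" 0]) (auto simp: density_1 nn_integral_distr)

text \<open>Two shears, y = x + D and x = m - D/2. Each is a translation in one variable while the
  other is fixed, so the Jacobian is 1.\<close>

lemma nn_integral_midpoint:
  fixes f :: "'a::euclidean_space \<times> 'a \<Rightarrow> ennreal"
  assumes [measurable]: "f \<in> borel_measurable borel"
  shows "(\<integral>\<^sup>+p. f p \<partial>lborel) = (\<integral>\<^sup>+D. \<integral>\<^sup>+m. f (m - D /\<^sub>R 2, m + D /\<^sub>R 2) \<partial>lborel \<partial>lborel)"
proof -
  have "(\<integral>\<^sup>+p. f p \<partial>lborel) = (\<integral>\<^sup>+x. \<integral>\<^sup>+y. f (x, y) \<partial>lborel \<partial>lborel)"
    by (rule nn_integral_lborel_pair) measurable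
  also have "\<dots> = (\<integral>\<^sup>+x. \<integral>\<^sup>+D. f (x, x + D) \<partial>lborel \<partial>lborel)"
    by (intro nn_integral_cong nn_integral_lborel_translate) measurable
  also have "\<dots> = (\<integral>\<^sup>+D. \<integral>\<^sup>+x. f (x, x + D) \<partial>lborel \<partial>lborel)"
    by (rule lborel_pair.Fubini') (auto simp: borel_prod)
  also have "\<dots> = (\<integral>\<^sup>+D. \<integral>\<^sup>+m. f (- (D /\<^sub>R 2) + m, - (D /\<^sub>R 2) + m + D) \<partial>lborel \<partial>lborel)"
    by (intro nn_integral_cong nn_integral_lborel_translate) measurable
  also have "\<dots> = (\<integral>\<^sup>+D. \<integral>\<^sup>+m. f (m - D /\<^sub>R 2, m + D /\<^sub>R 2) \<partial>lborel \<partial>lborel)"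
  proof (intro nn_integral_cong arg_cong[where f = f])
    fix D m :: 'a
    define h where "h = D /\<^sub>R 2"
    have "D = h + h" unfolding h_def by (simp flip: scaleR_2)
    then show "(- (D /\<^sub>R 2) + m, - (D /\<^sub>R 2) + m + D) = (m - D /\<^sub>R 2, m + D /\<^sub>R 2)"
      unfolding h_def[symmetric] by simp
  qed
  finally show ?thesis .
qed

lemma nn_integral_unit_window:
  fixes t :: real and k :: ennreal
  shows "(\<integral>\<^sup>+x. k * indicator {0..1} (x + t) \<partial>lborel) = k"
proof -
  have "(\<integral>\<^sup>+x. k * indicator {0..1} (x + t) \<partial>lborel) = (\<integral>\<^sup>+x. k * indicator {- t..1 - t} x \<partial>lborel)"
    by (intro nn_integral_cong) (auto simp: indicator_def)
  also have "\<dots> = k" by (subst nn_integral_cmult_indicator) auto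
  finally show ?thesis .
qed

text \<open>Substitution \<open>p = s + w\<close>, \<open>w = p * \<tau>\<close>.\<close>

lemma nn_integral_radius_angle:
  fixes b :: "real \<Rightarrow> ennreal"
  assumes [measurable]: "b \<in> borel_measurable borel"
  shows "(\<integral>\<^sup>+w. \<integral>\<^sup>+s. ennreal (sqrt w) * (ennreal (exp (- (c * sqrt (s + w) ^ 3))) * b (w / (s + w)))
      * indicator {0..} s * indicator {0..} w \<partial>lborel \<partial>lborel)
    = (\<integral>\<^sup>+p. ennreal (exp (- (c * sqrt p ^ 3)) * (p * sqrt p)) * indicator {0..} p \<partial>lborel)
      * (\<integral>\<^sup>+\<tau>. ennreal (sqrt \<tau>) * b \<tau> * indicator {0..1} \<tau> \<partial>lborel)" (is "?L = ?I1 * ?I2")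
proof -
  let ?e = "\<lambda>p. ennreal (exp (- (c * sqrt p ^ 3)))"
  have "?L = (\<integral>\<^sup>+w. \<integral>\<^sup>+p. ennreal (sqrt w) * (?e p * b (w / p)) * indicator {0..} (p - w) * indicator {0..} w \<partial>lborel \<partial>lborel)"
  proof (rule nn_integral_cong)
    fix w :: real
    show "(\<integral>\<^sup>+s. ennreal (sqrt w) * (?e (s + w) * b (w / (s + w))) * indicator {0..} s * indicator {0..} w \<partial>lborel)
      = (\<integral>\<^sup>+p. ennreal (sqrt w) * (?e p * b (w / p)) * indicator {0..} (p - w) * indicator {0..} w \<partial>lborel)"
      by (subst nn_integral_real_affine[where c = 1 and t = "- w"]) auto
  qed
  also have "\<dots> = (\<integral>\<^sup>+p. \<integral>\<^sup>+w. ennreal (sqrt w) * (?e p * b (w / p)) * indicator {0..} (p - w) * indicator {0..} w \<partial>lborel \<partial>lborel)"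
    by (rule lborel_pair.Fubini') measurable
  also have "\<dots> = (\<integral>\<^sup>+p. ennreal (exp (- (c * sqrt p ^ 3)) * (p * sqrt p)) * indicator {0..} p * ?I2 \<partial>lborel)"
  proof (intro nn_integral_cong)
    fix p :: real
    show "(\<integral>\<^sup>+w. ennreal (sqrt w) * (?e p * b (w / p)) * indicator {0..} (p - w) * indicator {0..} w \<partial>lborel)
       = ennreal (exp (- (c * sqrt p ^ 3)) * (p * sqrt p)) * indicator {0..} p * ?I2"
    proof (cases "p > 0")
      case True
      have "(\<integral>\<^sup>+w. ennreal (sqrt w) * (?e p * b (w / p)) * indicator {0..} (p - w) * indicator {0..} w \<partial>lborel)
        = ennreal p * (\<integral>\<^sup>+\<tau>. ennreal (sqrt (p * \<tau>)) * (?e p * b \<tau>) * indicator {0..} (p - p * \<tau>) * indicator {0..} (p * \<tau>) \<partial>lborel)"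
        using True by (subst nn_integral_real_affine[where c = p and t = 0]) auto
      also have "\<dots> = ennreal p * (\<integral>\<^sup>+\<tau>. (ennreal (sqrt p) * ?e p) * (ennreal (sqrt \<tau>) * b \<tau> * indicator {0..1} \<tau>) \<partial>lborel)"
      proof (intro arg_cong[where f = "\<lambda>x. ennreal p * x"] nn_integral_cong)
        fix \<tau> :: real
        have "ennreal (sqrt (p * \<tau>)) = ennreal (sqrt p) * ennreal (sqrt \<tau>)" if "\<tau> \<ge> 0"
          using True that by (simp add: real_sqrt_mult ennreal_mult)
        moreover have "p - p * \<tau> \<ge> 0 \<longleftrightarrow> \<tau> \<le> 1" "p * \<tau> \<ge> 0 \<longleftrightarrow> \<tau> \<ge> 0"
          using True by (auto simp: zero_le_mult_iff)
        ultimately show "ennreal (sqrt (p * \<tau>)) * (?e p * b \<tau>) * indicator {0..} (p - p * \<tau>) * indicator {0..} (p * \<tau>)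
          = (ennreal (sqrt p) * ?e p) * (ennreal (sqrt \<tau>) * b \<tau> * indicator {0..1} \<tau>)"
          by (auto simp: indicator_def mult_ac)
      qed
      also have "\<dots> = ennreal p * ((ennreal (sqrt p) * ?e p) * ?I2)"
        by (subst nn_integral_cmult) auto
      also have "\<dots> = ennreal (exp (- (c * sqrt p ^ 3)) * (p * sqrt p)) * ?I2"
        using True by (simp add: ennreal_mult mult_ac)
      finally show ?thesis using True by simp
    next
      \<comment> \<open>For \<open>p = 0\<close> the indicators leave only \<open>w = 0\<close>,
        where the factor \<open>sqrt w\<close> vanishes; for negative \<open>p\<close> they leave
        nothing.\<close>
      case False
      then have "(\<integral>\<^sup>+w. ennreal (sqrt w) * (?e p * b (w / p)) * indicator {0..} (p - w) * indicator {0..} w \<partial>lborel)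
         = (\<integral>\<^sup>+(w::real). 0 \<partial>lborel)"
        by (intro nn_integral_cong) (auto simp: indicator_def)
      then show ?thesis using False by (auto simp: indicator_def)
    qed
  qed
  also have "\<dots> = ?I1 * ?I2"
    by (intro nn_integral_multc) measurable
  finally show ?thesis .
qed

text \<open>The constant is read off in spherical coordinates: the integral of D_1 / |D| over the
  unit half sphere is pi, and at |D| = 2 sqrt w the radial part is 4 w dw / sqrt w; with the factor
  pi of the integrand this gives 4 pi^2 sqrt w dw. The proof uses a = D_1 and the squared norm t of
  the other two coordinates, which has density pi. Then w = (a^2 + t) / 4 replaces t, and a ranges
  over (0, 2 sqrt w].\<close>

lemma nn_integral_half_space_radial:
  fixes G :: "real \<Rightarrow> ennreal"
  assumes [measurable]: "G \<in> borel_measurable borel"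
  shows "(\<integral>\<^sup>+D. indicator {0<..} (D $ 1) * (ennreal (pi * D $ 1 / norm D) * G ((norm D)\<^sup>2 / 4)) \<partial>(lborel :: (real^3) measure))
    = ennreal (4 * pi\<^sup>2) * (\<integral>\<^sup>+w. ennreal (sqrt w) * G w * indicator {0..} w \<partial>lborel)"
proof -
  define F where "F a t = indicator {0<..} a * (ennreal (pi * a / sqrt (a\<^sup>2 + t)) * G ((a\<^sup>2 + t) / 4))" for a t :: real
  have [measurable]: "(\<lambda>x. F (f x) (g x)) \<in> borel_measurable N"
    if [measurable]: "f \<in> borel_measurable N" "g \<in> borel_measurable N" for f g and N :: "'x measure"
    unfolding F_def by measurable
  have nrm: "(norm (vector [a, fst q, snd q] :: real^3))\<^sup>2 = a\<^sup>2 + ((fst q)\<^sup>2 + (snd q)\<^sup>2)" for a q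
    unfolding power2_norm_eq_inner by (simp add: inner_vec_def sum_3 power2_eq_square)
  have nrm': "norm (vector [a, fst q, snd q] :: real^3) = sqrt (a\<^sup>2 + ((fst q)\<^sup>2 + (snd q)\<^sup>2))" for a q
    using nrm by (metis norm_ge_zero real_sqrt_unique)
  have "(\<integral>\<^sup>+D. indicator {0<..} (D $ 1) * (ennreal (pi * D $ 1 / norm D) * G ((norm D)\<^sup>2 / 4)) \<partial>(lborel :: (real^3) measure))
     = (\<integral>\<^sup>+a. \<integral>\<^sup>+q. F a ((fst q)\<^sup>2 + (snd q)\<^sup>2) \<partial>(lborel :: (real \<times> real) measure) \<partial>lborel)"
    by (subst nn_integral_real3(2)) (auto simp: F_def nrm nrm')
  also have "\<dots> = (\<integral>\<^sup>+a. ennreal pi * (\<integral>\<^sup>+t. F a t * indicator {0..} t \<partial>lborel) \<partial>lborel)"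
    by (intro nn_integral_cong nn_integral_sum_squares) measurable
  also have "\<dots> = ennreal pi * (\<integral>\<^sup>+a. \<integral>\<^sup>+t. F a t * indicator {0..} t \<partial>lborel \<partial>lborel)"
    by (intro nn_integral_cmult) measurable
  also have "(\<integral>\<^sup>+a. \<integral>\<^sup>+t. F a t * indicator {0..} t \<partial>lborel \<partial>lborel)
     = (\<integral>\<^sup>+a. ennreal 4 * (\<integral>\<^sup>+w. F a (- a\<^sup>2 + 4 * w) * indicator {0..} (- a\<^sup>2 + 4 * w) \<partial>lborel) \<partial>lborel)"
  proof (intro nn_integral_cong)
    fix a :: real
    show "(\<integral>\<^sup>+t. F a t * indicator {0..} t \<partial>lborel) = ennreal 4 * (\<integral>\<^sup>+w. F a (- a\<^sup>2 + 4 * w) * indicator {0..} (- a\<^sup>2 + 4 * w) \<partial>lborel)"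
      by (subst nn_integral_real_affine[where c = 4 and t = "- a\<^sup>2"]) auto
  qed
  also have "\<dots> = ennreal 4 * (\<integral>\<^sup>+a. \<integral>\<^sup>+w. F a (- a\<^sup>2 + 4 * w) * indicator {0..} (- a\<^sup>2 + 4 * w) \<partial>lborel \<partial>lborel)"
    by (intro nn_integral_cmult) measurable
  also have "(\<integral>\<^sup>+a. \<integral>\<^sup>+w. F a (- a\<^sup>2 + 4 * w) * indicator {0..} (- a\<^sup>2 + 4 * w) \<partial>lborel \<partial>lborel)
     = (\<integral>\<^sup>+w. \<integral>\<^sup>+a. F a (- a\<^sup>2 + 4 * w) * indicator {0..} (- a\<^sup>2 + 4 * w) \<partial>lborel \<partial>lborel)"
    by (rule lborel_pair.Fubini') measurable
  also have "\<dots> = (\<integral>\<^sup>+w. ennreal pi * (ennreal (sqrt w) * G w * indicator {0..} w) \<partial>lborel)"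
  proof (intro nn_integral_cong)
    fix w :: real
    show "(\<integral>\<^sup>+a. F a (- a\<^sup>2 + 4 * w) * indicator {0..} (- a\<^sup>2 + 4 * w) \<partial>lborel)
      = ennreal pi * (ennreal (sqrt w) * G w * indicator {0..} w)"
    proof (cases "w > 0")
      case True
      have sq: "a\<^sup>2 \<le> 4 * w \<longleftrightarrow> a \<le> 2 * sqrt w" if "a > 0" for a
      proof -
        have "a\<^sup>2 \<le> 4 * w \<longleftrightarrow> sqrt (a\<^sup>2) \<le> sqrt (4 * w)" by (simp only: real_sqrt_le_iff)
        then show ?thesis using that by (simp add: real_sqrt_mult)
      qed
      have s4: "sqrt (4 * w) = 2 * sqrt w" "sqrt (w * 4) = 2 * sqrt w" by (simp_all add: real_sqrt_mult)
      have "(\<integral>\<^sup>+a. F a (- a\<^sup>2 + 4 * w) * indicator {0..} (- a\<^sup>2 + 4 * w) \<partial>lborel)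
         = (\<integral>\<^sup>+a. G w * (ennreal (pi * a / (2 * sqrt w)) * indicator {0..2 * sqrt w} a) \<partial>lborel)"
      proof (intro nn_integral_cong)
        fix a :: real
        consider "a \<le> 0" | "a > 0" by linarith
        then show "F a (- a\<^sup>2 + 4 * w) * indicator {0..} (- a\<^sup>2 + 4 * w)
           = G w * (ennreal (pi * a / (2 * sqrt w)) * indicator {0..2 * sqrt w} a)"
        proof cases
          case 1
          then show ?thesis by (cases "a = 0") (auto simp: F_def)
        next
          case 2
          then show ?thesis using sq[OF 2] by (auto simp: F_def s4 indicator_def mult_ac)
        qed
      qed
      also have "\<dots> = G w * (\<integral>\<^sup>+a. ennreal (pi * a / (2 * sqrt w)) * indicator {0..2 * sqrt w} a \<partial>lborel)"
        by (intro nn_integral_cmult) measurable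
      also have "(\<integral>\<^sup>+a. ennreal (pi * a / (2 * sqrt w)) * indicator {0..2 * sqrt w} a \<partial>lborel)
         = ennreal (pi * (2 * sqrt w)\<^sup>2 / (4 * sqrt w) - pi * 0\<^sup>2 / (4 * sqrt w))"
        using True by (intro nn_integral_FTC_Icc[where F = "\<lambda>a. pi * a\<^sup>2 / (4 * sqrt w)"])
          (auto intro!: derivative_eq_intros simp: field_simps)
      also have "pi * (2 * sqrt w)\<^sup>2 / (4 * sqrt w) - pi * 0\<^sup>2 / (4 * sqrt w) = pi * sqrt w"
        using True by (simp add: power2_eq_square field_simps)
      finally show ?thesis using True by (simp add: ennreal_mult mult_ac)
    next
      case False
      have "F a (- a\<^sup>2 + 4 * w) * indicator {0..} (- a\<^sup>2 + 4 * w) = 0" for a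
      proof (cases "a > 0")
        case True
        then have "a\<^sup>2 > 0" by simp
        then have "- a\<^sup>2 + 4 * w < 0" using False by linarith
        then show ?thesis by simp
      qed (simp add: F_def)
      then have "(\<integral>\<^sup>+a. F a (- a\<^sup>2 + 4 * w) * indicator {0..} (- a\<^sup>2 + 4 * w) \<partial>lborel) = (\<integral>\<^sup>+(a::real). 0 \<partial>lborel)"
        by (intro nn_integral_cong)
      then show ?thesis using False by (auto simp: indicator_def simp del: mult_eq_0_iff)
    qed
  qed
  also have "\<dots> = ennreal pi * (\<integral>\<^sup>+w. ennreal (sqrt w) * G w * indicator {0..} w \<partial>lborel)"
    by (intro nn_integral_cmult) measurable
  also have "ennreal pi * (ennreal 4 * (ennreal pi * (\<integral>\<^sup>+w. ennreal (sqrt w) * G w * indicator {0..} w \<partial>lborel)))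
    = ennreal (4 * pi\<^sup>2) * (\<integral>\<^sup>+w. ennreal (sqrt w) * G w * indicator {0..} w \<partial>lborel)"
  proof -
    have "ennreal (4 * pi\<^sup>2) = ennreal pi * (ennreal 4 * ennreal pi)"
    proof -
      have "4 * pi\<^sup>2 = pi * (4 * pi)" by (simp add: power2_eq_square)
      then show ?thesis by (simp only: ennreal_mult pi_ge_zero zero_le_mult_iff zero_le_numeral)
        (simp add: ennreal_mult)
    qed
    then show ?thesis by (simp only: mult.assoc)
  qed
  finally show ?thesis .
qed


text \<open>Applied to the orientation of the angle, which is reversed by \<open>q \<mapsto> -q\<close> off a line.\<close>

lemma nn_integral_plane_symmetrize:
  fixes K :: "real \<times> real \<Rightarrow> ennreal" and H :: "real \<times> real \<Rightarrow> ennreal"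
  assumes [measurable]: "K \<in> borel_measurable borel"
    and "w \<noteq> 0" and eq: "\<And>q. w \<bullet> q \<noteq> 0 \<Longrightarrow> K q + K (- q) = H q"
  shows "2 * (\<integral>\<^sup>+q. K q \<partial>lborel) = (\<integral>\<^sup>+q. H q \<partial>lborel)"
proof -
  have "2 * (\<integral>\<^sup>+q. K q \<partial>lborel) = (\<integral>\<^sup>+q. K q \<partial>lborel) + (\<integral>\<^sup>+q. K (- q) \<partial>lborel)"
    by (simp add: mult_2 flip: nn_integral_lborel_uminus)
  also have "\<dots> = (\<integral>\<^sup>+q. K q + K (- q) \<partial>lborel)"
    by (intro nn_integral_add[symmetric]) measurable
  also have "\<dots> = (\<integral>\<^sup>+q. H q \<partial>lborel)"
  proof (rule nn_integral_cong_AE)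
    have "{q. w \<bullet> q = 0} \<in> null_sets lborel"
      using negligible_hyperplane[of w 0] \<open>w \<noteq> 0\<close>
      by (subst null_sets_completion_iff[symmetric]) (auto simp: negligible_iff_null_sets)
    then have "AE q in lborel. \<not> (w \<bullet> q = 0)" by (auto dest: AE_not_in)
    then show "AE q in lborel. K q + K (- q) = H q" by eventually_elim (rule eq)
  qed
  finally show ?thesis .
qed

text \<open>If \<open>D = Y - X\<close> and \<open>q\<close> collects the last two coordinates of the midpoint \<open>m\<close> of \<open>X\<close> and \<open>Y\<close>, then
  \<open>in_bisector D q\<close> is \<open>m - Z\<close>, where \<open>Z\<close> is the axis point equidistant from \<open>X\<close> and \<open>Y\<close>: it is the vector
  orthogonal to \<open>D\<close> with these two coordinates.\<close>

definition in_bisector :: "real^3 \<Rightarrow> real \<times> real \<Rightarrow> real^3" where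
  "in_bisector D q = vector [- (fst q * D $ 2 + snd q * D $ 3) / D $ 1, fst q, snd q]"

lemma inner_3: "(x :: real^3) \<bullet> y = x $ 1 * y $ 1 + x $ 2 * y $ 2 + x $ 3 * y $ 3"
  by (simp add: inner_vec_def sum_3)

lemma in_bisector_inner: "D $ 1 \<noteq> 0 \<Longrightarrow> in_bisector D q \<bullet> D = 0"
  by (simp add: in_bisector_def inner_3)

lemma in_bisector_uminus: "in_bisector D (- q) = - in_bisector D q"
  by (simp add: in_bisector_def vec_eq_iff forall_3 divide_simps)

text \<open>The orientation is the sign of a linear form in \<open>q\<close>: the triple product
  equals m . (D x u), and m is linear in \<open>q\<close>. If the form vanished identically, D x u
  would be a multiple of D; being orthogonal to D as well, it would be zero.\<close>

lemma cross_in_bisector_linear: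
  assumes "u \<noteq> 0" "D $ 1 \<noteq> 0" "cross3 D u \<noteq> 0"
  obtains w where "w \<noteq> 0" "\<And>q. cross3 (in_bisector D q) D \<bullet> u = w \<bullet> q"
proof
  define c where "c = cross3 D u"
  define w where "w = (c $ 2 - D $ 2 / D $ 1 * c $ 1, c $ 3 - D $ 3 / D $ 1 * c $ 1)"
  have "cross3 (in_bisector D q) D \<bullet> u = in_bisector D q \<bullet> c" for q
    by (simp add: c_def inner_3 cross_components algebra_simps)
  moreover have "in_bisector D q \<bullet> c = w \<bullet> q" for q
    using assms(2) by (simp add: w_def in_bisector_def inner_3 inner_prod_def field_simps)
  ultimately show "cross3 (in_bisector D q) D \<bullet> u = w \<bullet> q" for q
    by simp
  show "w \<noteq> 0"
  proof
    assume "w = 0"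
    then have c23: "c $ 2 = D $ 2 / D $ 1 * c $ 1" "c $ 3 = D $ 3 / D $ 1 * c $ 1"
      by (auto simp: w_def prod_eq_iff)
    have cD: "c = (c $ 1 / D $ 1) *\<^sub>R D"
      using assms(2) c23 by (simp add: vec_eq_iff forall_3)
    have "c \<bullet> D = 0" unfolding c_def by (simp add: dot_cross_self)
    then have "c \<bullet> c = 0" by (subst (2) cD) simp
    then show False using assms(3) by (simp add: c_def)
  qed
qed

text \<open>All \<open>D\<close> parallel to \<open>u\<close> lie in the plane orthogonal to u x e,
  for any \<open>e\<close> not parallel to \<open>u\<close>, because (u x e) . D = (D x u) .
  e.\<close>

lemma AE_cross3_ne_0:
  assumes "u \<noteq> 0"
  shows "AE D in lborel. cross3 D u \<noteq> 0"
proof -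
  have "\<exists>e. cross3 u e \<noteq> 0"
  proof (rule ccontr)
    assume "\<not> ?thesis"
    then have "cross3 u (axis 1 1) = 0" "cross3 u (axis 2 1) = 0" by auto
    then have "u = 0" by (simp add: vec_eq_iff forall_3 cross_components axis_def)
    then show False using assms by simp
  qed
  then obtain e where e: "cross3 u e \<noteq> 0" by blast
  have "{D. cross3 u e \<bullet> D = 0} \<in> null_sets lborel"
    using negligible_hyperplane[of "cross3 u e" 0] e
    by (subst null_sets_completion_iff[symmetric]) (auto simp: negligible_iff_null_sets)
  then have "AE D in lborel. \<not> (cross3 u e \<bullet> D = 0)" by (auto dest: AE_not_in)
  then show ?thesis
  proof eventually_elim
    case (elim D)
    have "cross3 u e \<bullet> D = cross3 D u \<bullet> e"
      by (simp add: inner_3 cross_components algebra_simps)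
    then show ?case using elim by auto
  qed
qed

lemma norm_in_bisector:
  assumes "D $ 1 \<noteq> 0"
  shows "(norm (in_bisector D q))\<^sup>2 = (1 + (D $ 2 / D $ 1)\<^sup>2) * (fst q)\<^sup>2
     + 2 * (D $ 2 * D $ 3 / (D $ 1)\<^sup>2) * fst q * snd q + (1 + (D $ 3 / D $ 1)\<^sup>2) * (snd q)\<^sup>2"
  using assms unfolding power2_norm_eq_inner
  by (simp add: in_bisector_def inner_3 power2_eq_square field_simps)

text \<open>The quadratic form |m - Z|^2 has determinant (|D| / D_1)^2. The factor D_1 / |D| is the
  cosine between \<open>D\<close> and the axis, the ratio by which projection along the axis shrinks
  areas of the bisecting plane.\<close>

lemma nn_integral_in_bisector:
  fixes F :: "real \<Rightarrow> ennreal"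
  assumes [measurable]: "F \<in> borel_measurable borel" and D: "D $ 1 > 0"
  shows "(\<integral>\<^sup>+q. F ((norm (in_bisector D q))\<^sup>2) \<partial>lborel)
     = ennreal (pi * D $ 1 / norm D) * (\<integral>\<^sup>+s. F s * indicator {0..} s \<partial>lborel)"
proof -
  have "(1 + (D $ 2 / D $ 1)\<^sup>2) * (1 + (D $ 3 / D $ 1)\<^sup>2) - (D $ 2 * D $ 3 / (D $ 1)\<^sup>2)\<^sup>2 = (norm D / D $ 1)\<^sup>2"
    using D unfolding power_divide power2_norm_eq_inner by (simp add: inner_3 power2_eq_square field_simps)
  moreover have "D \<noteq> 0" using D by auto
  then have "norm D / D $ 1 > 0" using D by simp
  moreover have "1 + (D $ 2 / D $ 1)\<^sup>2 > 0" by (intro add_pos_nonneg) auto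
  ultimately show ?thesis
    using D by (subst norm_in_bisector, simp, subst nn_integral_quadratic_form) auto
qed

subsection \<open>The integral over pairs of nuclei\<close>

lemma measurable_x_axis_point [measurable (raw)]:
  assumes [measurable]: "f \<in> borel_measurable M"
  shows "(\<lambda>x. x_axis_point (f x)) \<in> borel_measurable M"
proof -
  have "x_axis_point z = vector [z, 0, 0]" for z
    by (simp add: x_axis_point_def vec_eq_iff forall_3 axis_def)
  then show ?thesis by simp
qed

lemma measurable_axis_center [measurable (raw)]:
  assumes [measurable]: "f \<in> borel_measurable M"
  shows "(\<lambda>x. axis_center (f x)) \<in> borel_measurable M"
  unfolding axis_center_def by measurable

lemma measurable_oriented_angle [measurable (raw)]:
  assumes [measurable]: "f \<in> borel_measurable M" "g \<in> borel_measurable M" "h \<in> borel_measurable M"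
  shows "(\<lambda>x. oriented_angle u (f x) (g x) (h x)) \<in> borel_measurable M"
  unfolding oriented_angle_def Let_def by measurable

text \<open>The conditions on a pair that do not involve the process; membership and the empty ball
  are added by \<open>pairs_empty_ball\<close>.\<close>

definition facet_pairs :: "real^3 \<Rightarrow> real set \<Rightarrow> ((real^3) \<times> (real^3)) set" where
  "facet_pairs u B = {p. fst p $ 1 < snd p $ 1 \<and> axis_center p \<in> {0..1} \<and>
     oriented_angle u (x_axis_point (axis_center p)) (fst p) (snd p) \<in> B}"

lemma facet_pairs_measurable [measurable]:
  assumes [measurable]: "B \<in> sets borel"
  shows "facet_pairs u B \<in> sets borel"
  unfolding facet_pairs_def by measurable

lemma oriented_angle_translate: "oriented_angle u Z X Y = oriented_angle u 0 (X - Z) (Y - Z)"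
  by (simp add: oriented_angle_def Let_def)

text \<open>As \<open>m\<close> is orthogonal to \<open>D\<close>, both vectors have squared norm s
  + w and their inner product is s - w, where s = |m|^2 and w = |D|^2 / 4; hence the cosine 1 - 2 w
  / (s + w). Expanding the cross product leaves m x D.\<close>

lemma oriented_angle_bisector:
  assumes "m \<bullet> D = 0" "D \<noteq> 0"
  defines "\<alpha> \<equiv> arccos (1 - 2 * ((norm D)\<^sup>2 / 4 / ((norm m)\<^sup>2 + (norm D)\<^sup>2 / 4)))"
  shows "norm (m - D /\<^sub>R 2) = sqrt ((norm m)\<^sup>2 + (norm D)\<^sup>2 / 4)"
    and "oriented_angle u 0 (m - D /\<^sub>R 2) (m + D /\<^sub>R 2) = (if cross3 m D \<bullet> u > 0 then \<alpha> else 2 * pi - \<alpha>)"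
proof -
  let ?s = "(norm m)\<^sup>2" and ?w = "(norm D)\<^sup>2 / 4"
  have w: "?w > 0" using assms by simp
  have "D \<bullet> m = 0" using assms by (simp add: inner_commute)
  then have n: "(norm (m - D /\<^sub>R 2))\<^sup>2 = ?s + ?w" "(norm (m + D /\<^sub>R 2))\<^sup>2 = ?s + ?w"
    and i: "(m - D /\<^sub>R 2) \<bullet> (m + D /\<^sub>R 2) = ?s - ?w"
    using assms(1) unfolding power2_norm_eq_inner
    by (simp_all add: inner_diff_left inner_diff_right inner_add_left inner_add_right)
  then show n': "norm (m - D /\<^sub>R 2) = sqrt (?s + ?w)"
    by (metis norm_ge_zero real_sqrt_unique)
  moreover have "norm (m + D /\<^sub>R 2) = sqrt (?s + ?w)"
    using n by (metis norm_ge_zero real_sqrt_unique)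
  ultimately have "norm (m - D /\<^sub>R 2) * norm (m + D /\<^sub>R 2) = ?s + ?w" using w by simp
  moreover have "(?s - ?w) / (?s + ?w) = 1 - 2 * (?w / (?s + ?w))"
  proof -
    have "?s + ?w \<noteq> 0" using w by (intro less_imp_neq[symmetric] add_nonneg_pos) auto
    then show ?thesis by (simp add: divide_eq_eq diff_divide_distrib[symmetric] field_simps)
  qed
  moreover have "cross3 (m - D /\<^sub>R 2) (m + D /\<^sub>R 2) = cross3 m D"
    by (simp add: vec_eq_iff forall_3 cross_components field_simps)
  ultimately show "oriented_angle u 0 (m - D /\<^sub>R 2) (m + D /\<^sub>R 2) = (if cross3 m D \<bullet> u > 0 then \<alpha> else 2 * pi - \<alpha>)"
    using i by (simp add: oriented_angle_def Let_def \<alpha>_def)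
qed

text \<open>\<open>Z\<close> is the axis point with (m - Z) . D = 0, so its coordinate is (m . D) /
  D_1 = x + t. For fixed \<open>D\<close> and \<open>q\<close> it moves with \<open>x\<close> at
  unit speed, while the nuclei seen from \<open>Z\<close> stay put; so \<open>x\<close> enters the
  integrand only through the window.\<close>

lemma facet_pair_coordinates:
  fixes D :: "real^3" and q :: "real \<times> real" and x :: real
  assumes D: "D $ 1 > 0"
  defines "X \<equiv> vector [x, fst q, snd q] - D /\<^sub>R 2" and "Y \<equiv> vector [x, fst q, snd q] + D /\<^sub>R 2"
    and "t \<equiv> (fst q * D $ 2 + snd q * D $ 3) / D $ 1"
  shows "axis_center (X, Y) = x + t"
    and "X - x_axis_point (x + t) = in_bisector D q - D /\<^sub>R 2"
    and "Y - x_axis_point (x + t) = in_bisector D q + D /\<^sub>R 2"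
proof -
  have "(norm Y)\<^sup>2 - (norm X)\<^sup>2 = 2 * (vector [x, fst q, snd q] \<bullet> D)"
    unfolding X_def Y_def power2_norm_eq_inner
    by (simp add: inner_diff_left inner_diff_right inner_add_left inner_add_right inner_commute)
  then show "axis_center (X, Y) = x + t"
    using D by (simp add: axis_center_def X_def Y_def t_def inner_3 field_simps)
  have "vector [x, fst q, snd q] - x_axis_point (x + t) = in_bisector D q"
    using D by (simp add: vec_eq_iff forall_3 x_axis_point_def axis_def in_bisector_def t_def minus_divide_left)
  then show "X - x_axis_point (x + t) = in_bisector D q - D /\<^sub>R 2"
    "Y - x_axis_point (x + t) = in_bisector D q + D /\<^sub>R 2"
    unfolding X_def Y_def by (simp_all add: algebra_simps)
qed

text \<open>The constant 4/3 pi^2 is 1/2 * 4 pi^2 * 2/3: one half from averaging the orientations, 4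
  pi^2 from the integral over \<open>D\<close>, 2/3 from the radial integral.\<close>

lemma nn_integral_facet_pairs:
  assumes lam: "lam > 0" and u: "u \<noteq> 0" and [measurable]: "B \<in> sets borel" and B: "B \<subseteq> {0<..<2 * pi}"
  shows "(\<integral>\<^sup>+p. ennreal (exp (- (lam * (4 / 3 * pi * max 0 (dist (x_axis_point (axis_center p)) (fst p)) ^ 3))))
      * indicator (facet_pairs u B) p \<partial>lborel)
    = ennreal (4 / 3 * pi\<^sup>2 * (4 / 3 * pi * lam) powr (- 5 / 3) * Gamma (5 / 3)) *
      (\<integral>\<^sup>+t\<in>B. ennreal (\<bar>cos (t / 2)\<bar> * (sin (t / 2))\<^sup>2) \<partial>lborel)" (is "?J = _ * ?I2")
proof -
  define c where "c = 4 / 3 * pi * lam"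
  have c: "c > 0" using lam by (simp add: c_def)
  define b :: "real \<Rightarrow> ennreal" where "b \<tau> = indicator B (arccos (1 - 2 * \<tau>)) + indicator B (2 * pi - arccos (1 - 2 * \<tau>))" for \<tau>
  have [measurable]: "b \<in> borel_measurable borel" unfolding b_def by measurable
  define K where "K D q = ennreal (exp (- (c * norm (in_bisector D q - D /\<^sub>R 2) ^ 3))) *
     indicator B (oriented_angle u 0 (in_bisector D q - D /\<^sub>R 2) (in_bisector D q + D /\<^sub>R 2))" for D q
  have [measurable]: "(\<lambda>x. in_bisector (f x) (g x)) \<in> borel_measurable N"
    if [measurable]: "f \<in> borel_measurable N" "g \<in> borel_measurable N" for f g and N :: "'x measure"
    unfolding in_bisector_def by measurable
  have [measurable]: "(\<lambda>x. K (f x) (g x)) \<in> borel_measurable N"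
    if [measurable]: "f \<in> borel_measurable N" "g \<in> borel_measurable N" for f g and N :: "'x measure"
    unfolding K_def by measurable
  define F where "F w s = ennreal (exp (- (c * sqrt (s + w) ^ 3))) * b (w / (s + w))" for w s
  have [measurable]: "(\<lambda>x. F (f x) (g x)) \<in> borel_measurable N"
    if [measurable]: "f \<in> borel_measurable N" "g \<in> borel_measurable N" for f g and N :: "'x measure"
    unfolding F_def by measurable
  define G where "G w = (\<integral>\<^sup>+s. F w s * indicator {0..} s \<partial>lborel)" for w
  have [measurable]: "G \<in> borel_measurable borel" unfolding G_def by measurable
  let ?f = "\<lambda>p. ennreal (exp (- (lam * (4 / 3 * pi * max 0 (dist (x_axis_point (axis_center p)) (fst p)) ^ 3))))
      * indicator (facet_pairs u B) p"
  have "?J = (\<integral>\<^sup>+D. \<integral>\<^sup>+m. ?f (m - D /\<^sub>R 2, m + D /\<^sub>R 2) \<partial>lborel \<partial>lborel)"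
    by (rule nn_integral_midpoint) measurable
  also have "\<dots> = (\<integral>\<^sup>+D. indicator {0<..} (D $ 1) * (\<integral>\<^sup>+q. K D q \<partial>lborel) \<partial>lborel)"
  proof (rule nn_integral_cong)
    fix D :: "real^3"
    have "(\<integral>\<^sup>+m. ?f (m - D /\<^sub>R 2, m + D /\<^sub>R 2) \<partial>lborel)
       = (\<integral>\<^sup>+q. \<integral>\<^sup>+x. ?f (vector [x, fst q, snd q] - D /\<^sub>R 2, vector [x, fst q, snd q] + D /\<^sub>R 2) \<partial>lborel \<partial>lborel)"
      by (rule nn_integral_real3(1)) measurable
    also have "\<dots> = (\<integral>\<^sup>+q. indicator {0<..} (D $ 1) * K D q \<partial>lborel)"
    proof (rule nn_integral_cong)
      fix q :: "real \<times> real"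
      have "?f (vector [x, fst q, snd q] - D /\<^sub>R 2, vector [x, fst q, snd q] + D /\<^sub>R 2)
          = indicator {0<..} (D $ 1) * K D q * indicator {0..1} (x + (fst q * D $ 2 + snd q * D $ 3) / D $ 1)" for x
      proof (cases "D $ 1 > 0")
        case True
        note co = facet_pair_coordinates[OF True, of x q]
        let ?X = "vector [x, fst q, snd q] - D /\<^sub>R 2" and ?t = "(fst q * D $ 2 + snd q * D $ 3) / D $ 1"
        have "dist (x_axis_point (x + ?t)) ?X = norm (in_bisector D q - D /\<^sub>R 2)"
          by (metis co(2) dist_commute dist_norm)
        moreover have "oriented_angle u (x_axis_point (x + ?t)) ?X (vector [x, fst q, snd q] + D /\<^sub>R 2)
            = oriented_angle u 0 (in_bisector D q - D /\<^sub>R 2) (in_bisector D q + D /\<^sub>R 2)"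
          by (subst oriented_angle_translate) (simp only: co(2,3))
        ultimately show ?thesis
          using True co(1) by (simp add: facet_pairs_def K_def c_def indicator_def mult_ac)
      qed (simp add: facet_pairs_def)
      then show "(\<integral>\<^sup>+x. ?f (vector [x, fst q, snd q] - D /\<^sub>R 2, vector [x, fst q, snd q] + D /\<^sub>R 2) \<partial>lborel)
         = indicator {0<..} (D $ 1) * K D q"
        by (simp only: nn_integral_unit_window)
    qed
    also have "\<dots> = indicator {0<..} (D $ 1) * (\<integral>\<^sup>+q. K D q \<partial>lborel)"
      by (intro nn_integral_cmult) measurable
    finally show "(\<integral>\<^sup>+m. ?f (m - D /\<^sub>R 2, m + D /\<^sub>R 2) \<partial>lborel) = indicator {0<..} (D $ 1) * (\<integral>\<^sup>+q. K D q \<partial>lborel)" .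
  qed
  \<comment> \<open>The integral is doubled because the orientations at q and -q together produce
    \<open>b\<close>, which depends on the unoriented angle alone.\<close>
  finally have "2 * ?J = (\<integral>\<^sup>+D. 2 * (indicator {0<..} (D $ 1) * (\<integral>\<^sup>+q. K D q \<partial>lborel)) \<partial>lborel)"
    by (subst nn_integral_cmult) auto
  also have "\<dots> = (\<integral>\<^sup>+(D :: real^3). indicator {0<..} (D $ 1) * (ennreal (pi * D $ 1 / norm D) * G ((norm D)\<^sup>2 / 4)) \<partial>lborel)"
  proof (rule nn_integral_cong_AE[OF AE_mp[OF AE_cross3_ne_0[OF u] AE_I2[OF impI]]])
    fix D :: "real^3" assume Du: "cross3 D u \<noteq> 0"
    show "2 * (indicator {0<..} (D $ 1) * (\<integral>\<^sup>+q. K D q \<partial>lborel))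
      = indicator {0<..} (D $ 1) * (ennreal (pi * D $ 1 / norm D) * G ((norm D)\<^sup>2 / 4))"
    proof (cases "D $ 1 > 0")
      case True
      then have D1: "D $ 1 \<noteq> 0" and D0: "D \<noteq> 0" by auto
      obtain w where w: "w \<noteq> 0" "\<And>q. cross3 (in_bisector D q) D \<bullet> u = w \<bullet> q"
        using cross_in_bisector_linear[OF u D1 Du] by blast
      have "K D q + K D (- q) = F ((norm D)\<^sup>2 / 4) ((norm (in_bisector D q))\<^sup>2)" if q: "w \<bullet> q \<noteq> 0" for q
      proof -
        have orth: "in_bisector D q \<bullet> D = 0" "in_bisector D (- q) \<bullet> D = 0"
          using in_bisector_inner[OF D1] by auto
        have "norm (in_bisector D (- q)) = norm (in_bisector D q)" by (simp add: in_bisector_uminus)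
        then show ?thesis
          using q unfolding K_def oriented_angle_bisector[OF orth(1) D0] oriented_angle_bisector[OF orth(2) D0]
          by (auto simp: w(2) F_def b_def distrib_left add.commute)
      qed
      then have "2 * (\<integral>\<^sup>+q. K D q \<partial>lborel) = (\<integral>\<^sup>+q. F ((norm D)\<^sup>2 / 4) ((norm (in_bisector D q))\<^sup>2) \<partial>lborel)"
        by (intro nn_integral_plane_symmetrize[OF _ w(1)]) simp_all
      also have "\<dots> = ennreal (pi * D $ 1 / norm D) * G ((norm D)\<^sup>2 / 4)"
        unfolding G_def using True by (intro nn_integral_in_bisector) measurable
      finally show ?thesis using True by simp
    qed simp
  qed
  also have "\<dots> = ennreal (4 * pi\<^sup>2) * (\<integral>\<^sup>+w. ennreal (sqrt w) * G w * indicator {0..} w \<partial>lborel)"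
    by (rule nn_integral_half_space_radial) measurable
  also have "(\<integral>\<^sup>+w. ennreal (sqrt w) * G w * indicator {0..} w \<partial>lborel)
     = (\<integral>\<^sup>+w. \<integral>\<^sup>+s. ennreal (sqrt w) * (ennreal (exp (- (c * sqrt (s + w) ^ 3))) * b (w / (s + w)))
      * indicator {0..} s * indicator {0..} w \<partial>lborel \<partial>lborel)"
  proof (rule nn_integral_cong)
    fix w :: real
    show "ennreal (sqrt w) * G w * indicator {0..} w = (\<integral>\<^sup>+s. ennreal (sqrt w) * (ennreal (exp (- (c * sqrt (s + w) ^ 3))) * b (w / (s + w)))
      * indicator {0..} s * indicator {0..} w \<partial>lborel)"
      unfolding G_def F_def by (subst nn_integral_multc, simp, subst mult.assoc, subst nn_integral_cmult) (auto simp: mult.assoc)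
  qed
  also have "\<dots> = ennreal (2 / 3 * c powr (- 5 / 3) * Gamma (5 / 3)) * ?I2"
    using nn_integral_radius_angle[of b c] nn_integral_radial[OF c] nn_integral_angle[of B] B
    by (simp add: b_def)
  also have "ennreal (4 * pi\<^sup>2) * \<dots> = 2 * (ennreal (4 / 3 * pi\<^sup>2 * c powr (- 5 / 3) * Gamma (5 / 3)) * ?I2)"
  proof -
    have G0: "Gamma (5 / 3 :: real) > 0" by (intro Gamma_real_pos) simp
    have "ennreal (4 * pi\<^sup>2) * ennreal (2 / 3 * c powr (- 5 / 3) * Gamma (5 / 3))
        = ennreal (4 * pi\<^sup>2 * (2 / 3 * c powr (- 5 / 3) * Gamma (5 / 3)))"
      using G0 by (intro ennreal_mult[symmetric]) auto
    also have "4 * pi\<^sup>2 * (2 / 3 * c powr (- 5 / 3) * Gamma (5 / 3)) = 2 * (4 / 3 * pi\<^sup>2 * c powr (- 5 / 3) * Gamma (5 / 3))"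
      by simp
    also have "ennreal \<dots> = ennreal 2 * ennreal (4 / 3 * pi\<^sup>2 * c powr (- 5 / 3) * Gamma (5 / 3))"
      using G0 by (intro ennreal_mult) auto
    finally show ?thesis by (simp only: mult.assoc[symmetric]) simp
  qed
  finally show ?thesis by (simp add: ennreal_mult_cancel_left c_def)
qed

section \<open>General position almost surely, and the Palm distribution\<close>

context stationary_poisson
begin

text \<open>Pairs with equal first coordinates lie in a hyperplane of the space of pairs. For
  triples, once \<open>X\<close> and \<open>Y\<close> are fixed the third point lies on a sphere, a
  null set, and Tonelli's theorem gives a null set of triples.\<close>

lemma AE_generic_points: "AE \<omega> in M. generic_points (\<Phi> \<omega>)"
proof -
  define E1 where "E1 = {p :: (real^3) \<times> (real^3). fst p \<noteq> snd p \<and> fst p $ 1 = snd p $ 1}"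
  define E2 where "E2 = {t :: (real^3) \<times> (real^3) \<times> (real^3). fst (snd t) $ 1 < snd (snd t) $ 1 \<and>
     dist (x_axis_point (axis_center (snd t))) (fst t) = dist (x_axis_point (axis_center (snd t))) (fst (snd t))}"
  have "E1 \<in> null_sets lborel"
  proof (rule null_sets_subset)
    let ?a = "(axis 1 1, - axis 1 1) :: (real^3) \<times> (real^3)"
    have "?a \<noteq> 0" by (simp add: prod_eq_iff)
    then show "{p. ?a \<bullet> p = 0} \<in> null_sets lborel"
      using negligible_hyperplane[of ?a 0]
      by (subst null_sets_completion_iff[symmetric]) (auto simp: negligible_iff_null_sets)
    show "E1 \<in> sets lborel" unfolding E1_def by measurable
    show "E1 \<subseteq> {p. ?a \<bullet> p = 0}" by (auto simp: E1_def inner_prod_def inner_axis')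
  qed
  then have "AE \<omega> in M. \<Phi> \<omega> \<times> \<Phi> \<omega> \<inter> E1 = {}"
    by (rule AE_no_null_pair) (auto simp: E1_def)
  moreover have "E2 \<in> null_sets lborel"
  proof (rule null_setsI)
    show E2 [measurable]: "E2 \<in> sets lborel" unfolding E2_def by measurable
    have "emeasure lborel E2 = (\<integral>\<^sup>+t. indicator E2 t \<partial>lborel)"
      by (rule nn_integral_indicator[OF E2, symmetric])
    also have "\<dots> = (\<integral>\<^sup>+q. \<integral>\<^sup>+W. indicator E2 (W, q) \<partial>lborel \<partial>lborel)"
      using E2 by (intro nn_integral_lborel_pair(2)) auto
    also have "\<dots> = (\<integral>\<^sup>+(q :: (real^3) \<times> (real^3)). 0 \<partial>lborel)"
    proof (rule nn_integral_cong)
      fix q :: "(real^3) \<times> (real^3)"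
      let ?S = "sphere (x_axis_point (axis_center q)) (dist (x_axis_point (axis_center q)) (fst q))"
      have S: "?S \<in> null_sets lborel"
        using negligible_sphere
        by (subst null_sets_completion_iff[symmetric]) (auto simp: negligible_iff_null_sets)
      have "(\<integral>\<^sup>+W. indicator E2 (W, q) \<partial>lborel) \<le> (\<integral>\<^sup>+W. indicator ?S W \<partial>lborel)"
        by (intro nn_integral_mono) (auto simp: E2_def indicator_def)
      also have "\<dots> = emeasure lborel ?S" by simp
      also have "\<dots> = 0" using S by auto
      finally show "(\<integral>\<^sup>+W. indicator E2 (W, q) \<partial>lborel) = 0" by simp
    qed
    finally show "emeasure lborel E2 = 0" by simp
  qed
  then have "AE \<omega> in M. \<forall>W\<in>\<Phi> \<omega>. \<forall>X\<in>\<Phi> \<omega>. \<forall>Y\<in>\<Phi> \<omega>. W \<noteq> X \<longrightarrow> W \<noteq> Y \<longrightarrow> X \<noteq> Y \<longrightarrow> (W, X, Y) \<notin> E2"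
    by (rule AE_no_null_triple)
  ultimately show ?thesis using AE_space
  proof eventually_elim
    case (elim \<omega>)
    show ?case
    proof
      show "finite (\<Phi> \<omega> \<inter> B)" if "bounded B" for B using finite_points elim(3) that by blast
      show "X = Y" if "X \<in> \<Phi> \<omega>" "Y \<in> \<Phi> \<omega>" "X $ 1 = Y $ 1" for X Y
        using elim(1) that by (auto simp: E1_def)
      show "W = X \<or> W = Y" if "X \<in> \<Phi> \<omega>" "Y \<in> \<Phi> \<omega>" "W \<in> \<Phi> \<omega>" "X $ 1 < Y $ 1"
        "dist (x_axis_point (axis_center (X, Y))) W = dist (x_axis_point (axis_center (X, Y))) X" for X Y W
        using elim(2) that by (fastforce simp: E2_def)
    qed
  qed
qed

lemma palm_mark_distribution_facet_angle:
  assumes u: "u \<noteq> 0" and B: "B \<in> sets borel" "B \<subseteq> {0<..<2 * pi}"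
  shows "palm_mark_distribution M (facet_intensity lam)
           (\<lambda>\<omega>. axis_facet_points (\<Phi> \<omega>)) (\<lambda>\<omega>. facet_angle u (\<Phi> \<omega>)) B =
         (\<integral>\<^sup>+ t\<in>B. ennreal (3/4 * \<bar>cos (t/2)\<bar> * (sin (t/2))\<^sup>2) \<partial>lborel)"
proof -
  note [measurable] = B(1)
  define r where "r p = dist (x_axis_point (axis_center p)) (fst p)" for p
  define S where "S \<omega> = {p \<in> facet_pairs u B. fst p \<in> \<Phi> \<omega> \<and> snd p \<in> \<Phi> \<omega> \<and>
    \<Phi> \<omega> \<inter> ball (x_axis_point (axis_center p)) (r p) = {}}" for \<omega>
  let ?I2 = "\<integral>\<^sup>+t\<in>B. ennreal (\<bar>cos (t / 2)\<bar> * (sin (t / 2))\<^sup>2) \<partial>lborel"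
  define c where "c = 4 / 3 * pi * lam"
  have c: "c > 0" using lam_pos by (simp add: c_def)
  have G0: "Gamma (5 / 3 :: real) > 0" by (intro Gamma_real_pos) simp
  have "(\<integral>\<^sup>+\<omega>. (\<Sum>\<^sub>\<infinity>z\<in>axis_facet_points (\<Phi> \<omega>). indicator {0..1} z * indicator B (facet_angle u (\<Phi> \<omega>) z)) \<partial>M)
      = (\<integral>\<^sup>+\<omega>. cnt (S \<omega>) \<partial>M)"
  proof (rule nn_integral_cong_AE, use AE_generic_points in eventually_elim)
    fix \<omega> assume "generic_points (\<Phi> \<omega>)"
    then interpret generic_points "\<Phi> \<omega>" .
    have "S \<omega> = {p \<in> empty_ball_pairs (\<Phi> \<omega>). axis_center p \<in> {0..1} \<and>
        oriented_angle u (x_axis_point (axis_center p)) (fst p) (snd p) \<in> B}"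
      by (auto simp: S_def facet_pairs_def empty_ball_pairs_def r_def)
    then show "(\<Sum>\<^sub>\<infinity>z\<in>axis_facet_points (\<Phi> \<omega>). indicator {0..1} z * indicator B (facet_angle u (\<Phi> \<omega>) z)) = cnt (S \<omega>)"
      using infsum_marks by simp
  qed
  also have "\<dots> = ennreal lam ^ 2 * (\<integral>\<^sup>+p. ennreal (exp (- (lam * (4 / 3 * pi * max 0 (r p) ^ 3)))) * indicator (facet_pairs u B) p \<partial>lborel)"
    unfolding S_def
  proof (rule pairs_empty_ball)
    show "r \<in> borel_measurable borel" unfolding r_def by measurable
    show "r p \<le> dist (x_axis_point (axis_center p)) (snd p)" if "p \<in> facet_pairs u B" for p
      using that equidistant_iff[of "fst p" "snd p" "axis_center p"] by (simp add: r_def facet_pairs_def)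
  qed (auto simp: r_def facet_pairs_def)
  also have "\<dots> = ennreal lam ^ 2 * (ennreal (4 / 3 * pi\<^sup>2 * c powr (- 5 / 3) * Gamma (5 / 3)) * ?I2)"
    unfolding r_def nn_integral_facet_pairs[OF lam_pos u B] c_def ..
  finally have "palm_mark_distribution M (facet_intensity lam)
           (\<lambda>\<omega>. axis_facet_points (\<Phi> \<omega>)) (\<lambda>\<omega>. facet_angle u (\<Phi> \<omega>)) B
     = ennreal (1 / facet_intensity lam) * (ennreal lam ^ 2 * (ennreal (4 / 3 * pi\<^sup>2 * c powr (- 5 / 3) * Gamma (5 / 3)) * ?I2))"
    by (simp add: palm_mark_distribution_def)
  also have "\<dots> = ennreal (1 / facet_intensity lam * (lam\<^sup>2 * (4 / 3 * pi\<^sup>2 * c powr (- 5 / 3) * Gamma (5 / 3)))) * ?I2"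
  proof -
    have "0 \<le> 1 / facet_intensity lam" using G0 by (simp add: facet_intensity_def)
    then show ?thesis
      using lam_pos G0 by (simp only: ennreal_power ennreal_mult mult.assoc less_imp_le zero_le_power mult_nonneg_nonneg
         powr_ge_zero zero_le_power2 zero_le_numeral divide_nonneg_nonneg)
  qed
  \<comment> \<open>In terms of \<open>c\<close> = 4/3 pi lam, the factor lam^2 * 4/3 pi^2 is 3/4
    c^2. What remains, c^(2 - 5/3) Gamma (5/3), is exactly the intensity.\<close>
  also have "1 / facet_intensity lam * (lam\<^sup>2 * (4 / 3 * pi\<^sup>2 * c powr (- 5 / 3) * Gamma (5 / 3))) = 3 / 4"
  proof -
    have \<mu>: "facet_intensity lam = c powr (1 / 3) * Gamma (5 / 3)"
      using lam_pos powr_mult[of "4 * pi / 3" lam "1 / 3"] by (simp add: facet_intensity_def c_def)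
    have "lam\<^sup>2 * (4 / 3 * pi\<^sup>2) = 3 / 4 * c powr 2"
      using c by (simp add: powr_numeral c_def power2_eq_square)
    then have "lam\<^sup>2 * (4 / 3 * pi\<^sup>2 * c powr (- 5 / 3) * Gamma (5 / 3)) = 3 / 4 * (c powr 2 * c powr (- 5 / 3)) * Gamma (5 / 3)"
      by (simp add: mult_ac)
    also have "c powr 2 * c powr (- 5 / 3) = c powr (1 / 3)" by (simp flip: powr_add)
    finally show ?thesis unfolding \<mu> using c less_imp_neq[OF G0] by simp
  qed
  also have "ennreal (3 / 4) * ?I2 = (\<integral>\<^sup>+t\<in>B. ennreal (3/4 * \<bar>cos (t/2)\<bar> * (sin (t/2))\<^sup>2) \<partial>lborel)"
  proof -
    have "ennreal (3/4 * \<bar>cos (t/2)\<bar> * (sin (t/2))\<^sup>2) = ennreal (3/4) * ennreal (\<bar>cos (t/2)\<bar> * (sin (t/2))\<^sup>2)" for t :: real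
      by (subst ennreal_mult[symmetric]) (auto simp: mult.assoc)
    then show ?thesis by (simp only: mult.assoc) (subst nn_integral_cmult, auto)
  qed
  finally show ?thesis .
qed

end

theorem lemma5:
  fixes M :: "'w measure" and \<Phi> :: "'w \<Rightarrow> (real^3) set" and lam :: real and u :: "real^3"
    and B :: "real set"
  assumes "lam > 0"
    and "stationary_poisson_process M lam \<Phi>"
    and "u \<noteq> 0"
    and "B \<in> sets borel" and "B \<subseteq> {0<..<2*pi}"
  shows "palm_mark_distribution M (facet_intensity lam)
           (\<lambda>\<omega>. axis_facet_points (\<Phi> \<omega>)) (\<lambda>\<omega>. facet_angle u (\<Phi> \<omega>)) B =
         (\<integral>\<^sup>+ t\<in>B. ennreal (3/4 * \<bar>cos (t/2)\<bar> * (sin (t/2))\<^sup>2) \<partial>lborel)"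
proof -
  interpret prob_space M using assms(2) by (simp add: stationary_poisson_process_def)
  interpret stationary_poisson M lam \<Phi> by unfold_locales (use assms in auto)
  show ?thesis by (rule palm_mark_distribution_facet_angle[OF assms(3-5)])
qed

end
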